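(* Let $0<r<1$ and let $T$ be an invertible bounded operator on a complex Hilbert space $\mathcal H$. Then the following are equivalent: (1) $T\in C_{1,r}$; (2) $(1+r^2)I_{\mathcal H}-T^*T-r^2T^{-1}(T^{-1})^*\ge 0$; (3) $(T^*T)^{1/2}\in C_\alpha$; (4) $(T^*T)^{1/2}$ is an $A_r$-contraction; (5) there exist a unitary $U$ and an $A_r$-contraction $P$ on $\mathcal H$ such that $T=UP$.
   Context: All operators are bounded linear operators on complex Hilbert spaces. $A_r=\{z\in\mathbb C: r<|z|<1\}$, $\overline{A}_r=\{r\le|z|\le1\}$. $C_{1,r}$ is the class of invertible operators $T$ with $\|T\|\le1$ and $\|rT^{-1}\|\le1$. $C_\alpha$ is the class of invertible operators $T$ with $-{T^*}^2T^2+(1+r^2)T^*T-r^2I\ge0$. An operator $T$ is an $A_r$-contraction if $\overline{A}_r$ is a spectral set for $T$, i.e. $\sigma(T)\subseteq\overline{A}_r$ and $\|f(T)\|\le\sup_{z\in\overline{A}_r}|f(z)|$ for every rational function $f=p/q$ with poles off $\overline{A}_r$, where $f(T)=p(T)q(T)^{-1}$. *)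

theory Defs
  imports "HOL-Analysis.Analysis" "HOL-Computational_Algebra.Polynomial"
begin

text \<open>
  Complex Hilbert spaces. The inner product is linear in its first argument. Positive definiteness
  and \<open>norm x = sqrt \<langle>x, x\<rangle>\<close> are both contained in the last axiom, since \<open>norm\<close> is already a norm;
  completeness comes from \<^class>\<open>banach\<close>. The zero space is not excluded.
\<close>

class complex_hilbert = banach +
  fixes scaleC :: "complex \<Rightarrow> 'a \<Rightarrow> 'a" (infixr \<open>*\<^sub>C\<close> 75)
    and cinner :: "'a \<Rightarrow> 'a \<Rightarrow> complex"
  assumes scaleC_add_right: "c *\<^sub>C (x + y) = c *\<^sub>C x + c *\<^sub>C y"
    and scaleC_add_left: "(c + d) *\<^sub>C x = c *\<^sub>C x + d *\<^sub>C x"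
    and scaleC_scaleC: "c *\<^sub>C d *\<^sub>C x = (c * d) *\<^sub>C x"
    and scaleC_of_real: "complex_of_real t *\<^sub>C x = t *\<^sub>R x"
    and cinner_add_left: "cinner (x + y) z = cinner x z + cinner y z"
    and cinner_scaleC_left: "cinner (c *\<^sub>C x) y = c * cinner x y"
    and cinner_commute: "cinner x y = cnj (cinner y x)"
    and cinner_self: "cinner x x = complex_of_real ((norm x)\<^sup>2)"

instantiation complex :: complex_hilbert
begin

definition scaleC_complex :: "complex \<Rightarrow> complex \<Rightarrow> complex" where
  "scaleC_complex c x = c * x"

definition cinner_complex :: "complex \<Rightarrow> complex \<Rightarrow> complex" where
  "cinner_complex x y = x * cnj y"

instance
  by standard
    (simp_all add: scaleC_complex_def cinner_complex_def algebra_simps scaleR_conv_of_real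
      flip: complex_norm_square of_real_power)

end

text \<open>
  Operators are functions; their norm is \<^const>\<open>onorm\<close>, products are compositions, and sums and
  scalar multiples are written pointwise.
\<close>

definition bounded_clinear :: "('a::complex_hilbert \<Rightarrow> 'a) \<Rightarrow> bool" where
  "bounded_clinear T \<longleftrightarrow> bounded_linear T \<and> (\<forall>c x. T (c *\<^sub>C x) = c *\<^sub>C T x)"

text \<open>For an invertible operator the inverse is the library's \<^term>\<open>inv T\<close>.\<close>

definition invertible_op :: "('a::complex_hilbert \<Rightarrow> 'a) \<Rightarrow> bool" where
  "invertible_op T \<longleftrightarrow> bounded_clinear T \<and>
     (\<exists>S. bounded_clinear S \<and> S \<circ> T = id \<and> T \<circ> S = id)"

definition spectrum :: "('a::complex_hilbert \<Rightarrow> 'a) \<Rightarrow> complex set" where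
  "spectrum T = {z. \<not> invertible_op (\<lambda>x. z *\<^sub>C x - T x)}"

definition adj :: "('a::complex_hilbert \<Rightarrow> 'a) \<Rightarrow> 'a \<Rightarrow> 'a" where
  "adj T = (THE S. \<forall>x y. cinner (T x) y = cinner x (S y))"

definition unitary_op :: "('a::complex_hilbert \<Rightarrow> 'a) \<Rightarrow> bool" where
  "unitary_op U \<longleftrightarrow> bounded_clinear U \<and> adj U \<circ> U = id \<and> U \<circ> adj U = id"

definition positive_op :: "('a::complex_hilbert \<Rightarrow> 'a) \<Rightarrow> bool" where
  "positive_op A \<longleftrightarrow> bounded_clinear A \<and> (\<forall>x. cinner (A x) x \<in> \<real>\<^sub>\<ge>\<^sub>0)"

definition sqrt_op :: "('a::complex_hilbert \<Rightarrow> 'a) \<Rightarrow> 'a \<Rightarrow> 'a" where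
  "sqrt_op A = (THE P. positive_op P \<and> P \<circ> P = A)"

definition poly_op :: "complex poly \<Rightarrow> ('a::complex_hilbert \<Rightarrow> 'a) \<Rightarrow> 'a \<Rightarrow> 'a" where
  "poly_op p T = (\<lambda>x. \<Sum>i\<le>degree p. coeff p i *\<^sub>C (T ^^ i) x)"

definition closed_annulus :: "real \<Rightarrow> complex set" where
  "closed_annulus r = {z. r \<le> cmod z \<and> cmod z \<le> 1}"

definition C_1 :: "real \<Rightarrow> ('a::complex_hilbert \<Rightarrow> 'a) set" where
  "C_1 r = {T. invertible_op T \<and> onorm T \<le> 1 \<and> onorm (\<lambda>x. r *\<^sub>R inv T x) \<le> 1}"

definition C_alpha :: "real \<Rightarrow> ('a::complex_hilbert \<Rightarrow> 'a) set" where
  "C_alpha r = {T. invertible_op T \<and>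
     positive_op (\<lambda>x. - (adj T ^^ 2) ((T ^^ 2) x) + (1 + r\<^sup>2) *\<^sub>R adj T (T x) - r\<^sup>2 *\<^sub>R x)}"

text \<open>
  A rational function with poles off the annulus is given as \<open>p/q\<close> with \<open>q\<close> free of zeros there.
  The spectral inclusion then makes \<open>q(T)\<close> invertible, so that \<^const>\<open>inv\<close> is its genuine inverse.
\<close>

definition annulus_contraction :: "real \<Rightarrow> ('a::complex_hilbert \<Rightarrow> 'a) \<Rightarrow> bool" where
  "annulus_contraction r T \<longleftrightarrow> bounded_clinear T \<and> spectrum T \<subseteq> closed_annulus r \<and>
     (\<forall>p q. (\<forall>z\<in>closed_annulus r. poly q z \<noteq> 0) \<longrightarrow>
        onorm (poly_op p T \<circ> inv (poly_op q T))
          \<le> (SUP z\<in>closed_annulus r. cmod (poly p z / poly q z)))"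

end

theory Submission
  imports Defs "HOL-Computational_Algebra.Fundamental_Theorem_Algebra"
begin

text \<open>
  Let \<open>A = T\<^sup>*T\<close> and \<open>P = A\<^sup>1\<^sup>/\<^sup>2\<close>, so that \<open>\<parallel>P x\<parallel> = \<parallel>T x\<parallel>\<close>. All five conditions say that
  \<open>r\<^sup>2 \<le> A \<le> 1\<close>: the operator in (3) is \<open>(1 - A) (A - r\<^sup>2)\<close>, and (2) is the same inequality after
  the substitution \<open>x = P y\<close>. For the spectral set conditions, \<open>r \<le> P \<le> 1\<close> and a polynomial that
  is nonnegative on \<open>[r, 1]\<close> is nonnegative at \<open>P\<close>; applied to \<open>M\<^sup>2 |q|\<^sup>2 - |p|\<^sup>2\<close> this gives
  \<open>\<parallel>p(P) x\<parallel> \<le> M \<parallel>q(P) x\<parallel>\<close>. Conversely, the test functions \<open>z\<close> and \<open>1/z\<close> recover the two norm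
  bounds, and polar decomposition links (4) and (5).
\<close>

section \<open>Geometry of complex Hilbert spaces\<close>

text \<open>For a general operator the two norm bounds do not make the annulus a spectral set. For a
  positive \<open>P\<close> they do: the values of a polynomial on the segment \<open>[r, 1]\<close>
  already control it at \<open>P\<close>, and this segment lies in the annulus. The unitary factor
  in (5) accounts for the rest of \<open>T\<close>. Operator inequalities are handled throughout as
  inequalities between quadratic forms, and an approximate eigenvalue together with a factorisation
  into linear terms does the work of the spectral theorem. Invertibility of \<open>T\<close> gives
  \<open>A\<close> a strict lower bound \<open>c > 0\<close>. This makes the square root iteration a
  strict contraction, so that Banach's fixed point theorem applies, and it also makes uniqueness of
  the root short. Quotients of operators are avoided by comparing \<open>p(P) x\<close> with
  \<open>q(P) x\<close> for the same vector \<open>x\<close>.\<close>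

lemma cinner_add_right: "cinner x (y + z) = cinner x y + cinner x z"
  by (metis cinner_add_left cinner_commute complex_cnj_add)

lemma cinner_scaleC_right: "cinner x (c *\<^sub>C y) = cnj c * cinner x y"
  by (metis cinner_commute cinner_scaleC_left complex_cnj_mult)

lemma cinner_scaleR_left: "cinner (t *\<^sub>R x) y = of_real t * cinner x y"
  by (metis cinner_scaleC_left scaleC_of_real)

lemma cinner_scaleR_right: "cinner x (t *\<^sub>R y) = of_real t * cinner x y"
  by (metis cinner_scaleC_right complex_cnj_complex_of_real scaleC_of_real)

lemma cinner_minus_left: "cinner (- x) y = - cinner x y"
  using cinner_scaleR_left[of "-1" x y] by simp

lemma cinner_minus_right: "cinner x (- y) = - cinner x y"
  using cinner_scaleR_right[of x "-1" y] by simp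

lemma cinner_diff_left: "cinner (x - y) z = cinner x z - cinner y z"
  using cinner_add_left[of x "-y" z] by (simp add: cinner_minus_left)

lemma cinner_diff_right: "cinner x (y - z) = cinner x y - cinner x z"
  using cinner_add_right[of x y "-z"] by (simp add: cinner_minus_right)

lemma cinner_zero_left [simp]: "cinner 0 y = 0"
  using cinner_scaleR_left[of 0 0 y] by simp

lemma cinner_zero_right [simp]: "cinner x 0 = 0"
  using cinner_scaleR_right[of x 0 0] by simp

lemmas cinner_simps = cinner_add_left cinner_add_right cinner_diff_left cinner_diff_right
  cinner_minus_left cinner_minus_right cinner_scaleR_left cinner_scaleR_right
  cinner_scaleC_left cinner_scaleC_right

lemma Re_cinner_self: "Re (cinner x x) = (norm x)\<^sup>2"
  by (simp add: cinner_self)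

lemma Re_cinner_commute: "Re (cinner x y) = Re (cinner y x)"
  by (subst cinner_commute) simp

lemma norm_add_square: "(norm (x + y))\<^sup>2 = (norm x)\<^sup>2 + 2 * Re (cinner x y) + (norm y)\<^sup>2"
  for x y :: "'a::complex_hilbert"
  using Re_cinner_self[of "x + y"] Re_cinner_commute[of y x]
  by (simp add: cinner_simps Re_cinner_self)

lemma norm_diff_square: "(norm (x - y))\<^sup>2 = (norm x)\<^sup>2 - 2 * Re (cinner x y) + (norm y)\<^sup>2"
  for x y :: "'a::complex_hilbert"
  using norm_add_square[of x "-y"] by (simp add: cinner_minus_right)

lemma norm_scaleC: "norm (c *\<^sub>C x) = cmod c * norm x"
proof -
  have "complex_of_real ((norm (c *\<^sub>C x))\<^sup>2) = (c * cnj c) * complex_of_real ((norm x)\<^sup>2)"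
    by (metis cinner_self cinner_scaleC_left cinner_scaleC_right mult.assoc)
  also have "\<dots> = complex_of_real ((cmod c * norm x)\<^sup>2)"
    by (simp add: power_mult_distrib flip: complex_norm_square)
  finally have "(norm (c *\<^sub>C x))\<^sup>2 = (cmod c * norm x)\<^sup>2"
    using of_real_eq_iff by blast
  then show ?thesis
    by simp
qed

text \<open>The usual order is reversed: the triangle inequality is given with the norm, and
  squaring it yields the real part of Cauchy-Schwarz.\<close>

lemma Re_cinner_le: "Re (cinner x y) \<le> norm x * norm y"
proof -
  have "(norm (x + y))\<^sup>2 \<le> (norm x + norm y)\<^sup>2"
    by (simp add: norm_triangle_ineq power_mono)
  then show ?thesis
    by (simp add: norm_add_square power2_sum)
qed

text \<open>Multiplying \<open>x\<close> by a unimodular \<open>c\<close> turns the inner product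
  into its modulus without changing \<open>norm x\<close>, so the bound on real parts
  suffices.\<close>

lemma cmod_cinner_le: "cmod (cinner x y) \<le> norm x * norm y"
proof (cases "cinner x y = 0")
  case False
  define c where "c = cnj (sgn (cinner x y))"
  have "cmod c = 1"
    using False by (simp add: c_def norm_sgn)
  have "c * cinner x y = of_real (cmod (cinner x y))"
  proof -
    have "c * cinner x y = (cinner x y * cnj (cinner x y)) / of_real (cmod (cinner x y))"
      by (simp add: c_def sgn_eq)
    also have "\<dots> = of_real (cmod (cinner x y))"
      by (subst complex_norm_square[symmetric]) (simp add: power2_eq_square)
    finally show ?thesis .
  qed
  then have "cmod (cinner x y) = Re (cinner (c *\<^sub>C x) y)"
    by (simp add: cinner_simps)
  also have "\<dots> \<le> norm x * norm y"
    using Re_cinner_le[of "c *\<^sub>C x" y] \<open>cmod c = 1\<close> by (simp add: norm_scaleC)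
  finally show ?thesis .
qed simp

lemma cinner_ext: "x = y" if "\<And>z. cinner z x = cinner z y"
proof -
  have "cinner (x - y) (x - y) = 0"
    using that by (simp add: cinner_diff_right)
  then show ?thesis
    by (simp add: cinner_self)
qed

lemma bounded_linear_scaleC: "bounded_linear (\<lambda>x. c *\<^sub>C x)"
proof
  show "c *\<^sub>C (x + y) = c *\<^sub>C x + c *\<^sub>C y" for x y :: 'a
    by (rule scaleC_add_right)
  show "c *\<^sub>C t *\<^sub>R x = t *\<^sub>R c *\<^sub>C x" for t and x :: 'a
    by (metis mult.commute scaleC_of_real scaleC_scaleC)
  show "\<exists>K. \<forall>x::'a. norm (c *\<^sub>C x) \<le> norm x * K"
    by (metis norm_scaleC mult.commute order_refl)
qed

lemma bounded_linear_cinner_left: "bounded_linear (\<lambda>x. cinner x y)"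
proof
  show "\<exists>K. \<forall>x::'a. norm (cinner x y) \<le> norm x * K"
    using cmod_cinner_le by blast
qed (simp_all add: cinner_simps scaleR_conv_of_real)

lemma bounded_linear_cinner_right: "bounded_linear (\<lambda>y. cinner x y)"
proof
  show "\<exists>K. \<forall>y::'a. norm (cinner x y) \<le> norm y * K"
    using cmod_cinner_le by (metis mult.commute)
qed (simp_all add: cinner_simps scaleR_conv_of_real)

text \<open>
  The representing vector minimises \<open>\<parallel>x\<parallel>\<^sup>2 - 2 Re (f x)\<close>; the parallelogram law makes every
  minimising sequence Cauchy.
\<close>

theorem riesz_representation:
  fixes f :: "'a::complex_hilbert \<Rightarrow> complex"
  assumes f: "bounded_linear f" and fC: "\<And>c x. f (c *\<^sub>C x) = c * f x"
  obtains w where "\<And>x. f x = cinner x w"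
proof -
  interpret bounded_linear f by fact
  define \<phi> where "\<phi> x = (norm x)\<^sup>2 - 2 * Re (f x)" for x
  obtain K where K: "\<And>x. norm (f x) \<le> norm x * K"
    using bounded by blast
  have low: "- K\<^sup>2 \<le> \<phi> x" for x
  proof -
    have "Re (f x) \<le> norm x * K"
      using K[of x] complex_Re_le_cmod[of "f x"] by linarith
    moreover have "0 \<le> (norm x - K)\<^sup>2"
      by simp
    ultimately show ?thesis
      by (simp add: \<phi>_def power2_diff)
  qed
  define m where "m = Inf (range \<phi>)"
  have bdd: "bdd_below (range \<phi>)"
    using low by (auto intro!: bdd_belowI)
  have m_le: "m \<le> \<phi> x" for x
    unfolding m_def by (rule cInf_lower[OF _ bdd]) simp
  have "\<exists>x. \<phi> x < m + inverse (real (Suc n))" for n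
    using cInf_lessD[of "range \<phi>" "m + inverse (real (Suc n))"]
    by (auto simp: m_def)
  then obtain X where X: "\<And>n. \<phi> (X n) < m + inverse (real (Suc n))"
    by metis
  \<comment> \<open>The parallelogram law; the terms in \<open>f\<close> cancel because
    \<open>f\<close> at the midpoint is the mean of its two values.\<close>
  have par: "(norm (x - y))\<^sup>2 = 2 * \<phi> x + 2 * \<phi> y - 4 * \<phi> ((1/2) *\<^sub>R (x + y))" for x y
    by (simp add: \<phi>_def add scaleR norm_add_square norm_diff_square power_divide
        scaleR_conv_of_real) argo
  have "Cauchy X"
  proof (rule metric_CauchyI)
    fix e :: real
    assume "0 < e"
    obtain N where N: "inverse (real (Suc N)) < e\<^sup>2 / 4"
      using reals_Archimedean[of "e\<^sup>2/4"] \<open>0 < e\<close> by auto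
    have "dist (X i) (X j) < e" if "N \<le> i" "N \<le> j" for i j
    proof -
      have "inverse (real (Suc i)) \<le> inverse (real (Suc N))"
        "inverse (real (Suc j)) \<le> inverse (real (Suc N))"
        using that by (simp_all add: le_imp_inverse_le)
      then have "(norm (X i - X j))\<^sup>2 < e\<^sup>2"
        using par[of "X i" "X j"] X[of i] X[of j] N m_le[of "(1/2) *\<^sub>R (X i + X j)"] by argo
      then show ?thesis
        using \<open>0 < e\<close> by (simp add: dist_norm power_less_imp_less_base)
    qed
    then show "\<exists>N. \<forall>i\<ge>N. \<forall>j\<ge>N. dist (X i) (X j) < e"
      by blast
  qed
  then obtain w where w: "X \<longlonglongrightarrow> w"
    using Cauchy_convergent convergent_def by blast
  have "(\<lambda>n. \<phi> (X n)) \<longlonglongrightarrow> \<phi> w"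
    unfolding \<phi>_def by (intro tendsto_intros tendsto w)
  moreover have "(\<lambda>n. m + inverse (real (Suc n))) \<longlonglongrightarrow> m + 0"
    by (intro tendsto_intros LIMSEQ_inverse_real_of_nat)
  ultimately have "\<phi> w \<le> m + 0"
    using X by (intro LIMSEQ_le) (auto intro: less_imp_le)
  then have min: "\<phi> w \<le> \<phi> x" for x
    using m_le[of x] by simp
  have Re_eq: "Re (f h) = Re (cinner h w)" for h
  proof (rule ccontr)
    assume ne: "Re (f h) \<noteq> Re (cinner h w)"
    \<comment> \<open>Moving from \<open>w\<close> by a small multiple of \<open>h\<close> would
      lower \<open>\<phi>\<close>. The best multiple is \<open>d / (norm h)\<^sup>2\<close>; adding
      \<open>1\<close> to the denominator keeps it nonzero and still leads to a
      contradiction.\<close>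
    define d where "d = Re (f h) - Re (cinner h w)"
    define t where "t = d / ((norm h)\<^sup>2 + 1)"
    have pos: "0 < (norm h)\<^sup>2 + 1"
      by (simp add: add_nonneg_pos)
    have "\<phi> (w + t *\<^sub>R h) = \<phi> w - 2 * t * d + t\<^sup>2 * (norm h)\<^sup>2"
      using Re_cinner_commute[of w h]
      by (simp add: \<phi>_def add scaleR norm_add_square cinner_simps d_def power_mult_distrib
          algebra_simps)
    then have "2 * t * d \<le> t\<^sup>2 * (norm h)\<^sup>2"
      using min[of "w + t *\<^sub>R h"] by simp
    also have "\<dots> \<le> t\<^sup>2 * ((norm h)\<^sup>2 + 1)"
      by (simp add: mult_left_mono)
    also have "\<dots> = t * d"
      using pos by (simp add: t_def power2_eq_square)
    finally have "t * d \<le> 0"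
      by (simp add: mult.commute)
    moreover have "0 < t * d"
      using ne pos by (simp add: t_def d_def zero_less_divide_iff zero_less_mult_iff)
        linarith
    ultimately show False
      by simp
  qed
  have "f x = cinner x w" for x
  proof (rule complex_eqI)
    \<comment> \<open>By complex linearity, the imaginary part at \<open>x\<close> is minus the real
      part at \<open>\<i> *\<^sub>C x\<close>.\<close>
    show "Im (f x) = Im (cinner x w)"
      using Re_eq[of "\<i> *\<^sub>C x"] by (simp add: fC cinner_simps)
  qed (rule Re_eq)
  then show thesis
    using that by blast
qed

section \<open>Bounded operators, adjoints and invertibility\<close>

lemma bounded_clinearD:
  assumes "bounded_clinear T"
  shows "bounded_linear T" "T (c *\<^sub>C x) = c *\<^sub>C T x" "T (x + y) = T x + T y" "T (x - y) = T x - T y"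
    "T (t *\<^sub>R x) = t *\<^sub>R T x" "T 0 = 0" "T (- x) = - T x"
proof -
  show bl: "bounded_linear T" and "T (c *\<^sub>C x) = c *\<^sub>C T x"
    using assms by (auto simp: bounded_clinear_def)
  show "T (x + y) = T x + T y" "T (x - y) = T x - T y"
    "T (t *\<^sub>R x) = t *\<^sub>R T x" "T 0 = 0" "T (- x) = - T x"
    using bounded_linear.linear[OF bl]
    by (simp_all add: linear_add linear_diff linear_scale linear_0 linear_neg)
qed

lemma bounded_clinearI:
  assumes "\<And>x y. T (x + y) = T x + T y" and "\<And>c x. T (c *\<^sub>C x) = c *\<^sub>C T x"
    and "\<And>x. norm (T x) \<le> K * norm x"
  shows "bounded_clinear T"
  unfolding bounded_clinear_def
proof (intro conjI allI)
  show "bounded_linear T"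
    using assms by (intro bounded_linear_intro[of _ K])
      (auto simp: mult.commute simp flip: scaleC_of_real)
qed (rule assms)

lemma bounded_clinear_bound:
  assumes "bounded_clinear T"
  obtains K where "0 < K" "\<And>x. norm (T x) \<le> K * norm x"
  using bounded_linear.pos_bounded[OF bounded_clinearD(1)[OF assms]] by (metis mult.commute)

lemma bounded_clinear_comp:
  "bounded_clinear S \<Longrightarrow> bounded_clinear T \<Longrightarrow> bounded_clinear (\<lambda>x. S (T x))"
  by (auto simp: bounded_clinear_def intro: bounded_linear_compose)

lemma scaleC_one [simp]: "1 *\<^sub>C x = x"
  using scaleC_of_real[of 1 x] by simp

lemma scaleC_zero_left [simp]: "0 *\<^sub>C x = 0"
  using scaleC_of_real[of 0 x] by simp

lemma scaleC_minus_left: "(- c) *\<^sub>C x = - (c *\<^sub>C x)"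
  using scaleC_add_left[of c "-c" x] by (simp add: eq_neg_iff_add_eq_0 add.commute)

lemma scaleC_scaleR_commute: "c *\<^sub>C t *\<^sub>R x = t *\<^sub>R c *\<^sub>C x"
  by (metis mult.commute scaleC_of_real scaleC_scaleC)

lemma scaleC_diff_right: "c *\<^sub>C (x - y) = c *\<^sub>C x - c *\<^sub>C y"
  using linear_diff[OF bounded_linear.linear[OF bounded_linear_scaleC]] .

lemma scaleC_minus_right: "c *\<^sub>C (- x) = - (c *\<^sub>C x)"
  using linear_neg[OF bounded_linear.linear[OF bounded_linear_scaleC]] .

lemma scaleC_zero_right [simp]: "c *\<^sub>C 0 = 0"
  using linear_0[OF bounded_linear.linear[OF bounded_linear_scaleC]] .

lemma scaleC_commute: "c *\<^sub>C d *\<^sub>C x = d *\<^sub>C c *\<^sub>C x"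
  by (simp add: scaleC_scaleC mult.commute)

lemma bounded_clinear_ident: "bounded_clinear (\<lambda>x. x)"
  by (simp add: bounded_clinear_def)

lemma bounded_clinear_scaleC: "bounded_clinear T \<Longrightarrow> bounded_clinear (\<lambda>x. c *\<^sub>C T x)"
  by (auto simp: bounded_clinear_def scaleC_commute
      intro: bounded_linear_compose[OF bounded_linear_scaleC])

lemma bounded_clinear_scaleR: "bounded_clinear T \<Longrightarrow> bounded_clinear (\<lambda>x. t *\<^sub>R T x)"
  using bounded_clinear_scaleC[of T "of_real t"] by (simp add: scaleC_of_real)

lemma bounded_clinear_add:
  "bounded_clinear S \<Longrightarrow> bounded_clinear T \<Longrightarrow> bounded_clinear (\<lambda>x. S x + T x)"
  by (auto simp: bounded_clinear_def scaleC_add_right intro: bounded_linear_add)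

lemma bounded_clinear_minus: "bounded_clinear T \<Longrightarrow> bounded_clinear (\<lambda>x. - T x)"
  by (auto simp: bounded_clinear_def scaleC_minus_right intro: bounded_linear_minus)

lemma bounded_clinear_diff:
  "bounded_clinear S \<Longrightarrow> bounded_clinear T \<Longrightarrow> bounded_clinear (\<lambda>x. S x - T x)"
  by (auto simp: bounded_clinear_def scaleC_diff_right intro: bounded_linear_sub)

lemmas bounded_clinear_intros = bounded_clinear_ident bounded_clinear_scaleC
  bounded_clinear_scaleR bounded_clinear_add bounded_clinear_diff bounded_clinear_minus

section \<open>Adjoints\<close>

lemma adj_eqI: "adj T = S" if "\<And>x y. cinner (T x) y = cinner x (S y)"
  unfolding adj_def
proof (rule the_equality)
  fix S'
  assume "\<forall>x y. cinner (T x) y = cinner x (S' y)"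
  then have "cinner z (S' y) = cinner z (S y)" for z y
    using that by metis
  then show "S' = S"
    using cinner_ext by blast
qed (use that in blast)

lemma cinner_adj:
  assumes "bounded_clinear T"
  shows "cinner (T x) y = cinner x (adj T y)"
proof -
  have "\<exists>w. \<forall>x. cinner (T x) y = cinner x w" for y
  proof -
    have "bounded_linear (\<lambda>x. cinner (T x) y)"
      by (rule bounded_linear_compose[OF bounded_linear_cinner_left bounded_clinearD(1)[OF assms]])
    then obtain w where "\<And>x. cinner (T x) y = cinner x w"
      by (rule riesz_representation)
        (simp_all add: bounded_clinearD(2)[OF assms] cinner_scaleC_left)
    then show ?thesis
      by blast
  qed
  then obtain S where "\<And>x y. cinner (T x) y = cinner x (S y)"
    by metis
  with adj_eqI[of T S] show ?thesis
    by simp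
qed

lemma cinner_adj_left: "bounded_clinear T \<Longrightarrow> cinner (adj T x) y = cinner x (T y)"
  by (metis cinner_adj cinner_commute)

lemma bounded_clinear_adj:
  assumes "bounded_clinear T"
  shows "bounded_clinear (adj T)"
proof -
  obtain K where K: "0 < K" "\<And>x. norm (T x) \<le> K * norm x"
    using bounded_clinear_bound[OF assms] by metis
  show ?thesis
  proof (rule bounded_clinearI)
    show "adj T (x + y) = adj T x + adj T y" for x y
      by (rule cinner_ext) (simp add: cinner_add_right flip: cinner_adj[OF assms])
    show "adj T (c *\<^sub>C x) = c *\<^sub>C adj T x" for c x
      by (rule cinner_ext) (simp add: cinner_scaleC_right flip: cinner_adj[OF assms])
    show "norm (adj T y) \<le> K * norm y" for y
    proof (cases "adj T y = 0")
      case False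
      \<comment> \<open>Testing the adjoint identity on \<open>adj T y\<close> itself leaves one
        factor \<open>norm (adj T y)\<close> to cancel.\<close>
      have "(norm (adj T y))\<^sup>2 = Re (cinner (T (adj T y)) y)"
        by (simp add: cinner_adj[OF assms] Re_cinner_self)
      also have "\<dots> \<le> norm (T (adj T y)) * norm y"
        by (rule Re_cinner_le)
      also have "\<dots> \<le> K * norm (adj T y) * norm y"
        by (simp add: K mult_right_mono)
      finally show ?thesis
        using False by (simp add: power2_eq_square)
    qed (use K in simp)
  qed
qed

section \<open>Invertible operators\<close>

lemma invertible_opD:
  assumes "invertible_op T"
  shows "bounded_clinear T" "bounded_clinear (inv T)" "T (inv T x) = x" "inv T (T x) = x" "bij T"
proof -
  obtain S where S: "bounded_clinear T" "bounded_clinear S" "S \<circ> T = id" "T \<circ> S = id"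
    using assms by (auto simp: invertible_op_def)
  then have "inv T = S"
    by (metis inv_unique_comp)
  with S show "bounded_clinear T" "bounded_clinear (inv T)" "T (inv T x) = x" "inv T (T x) = x"
    by (simp_all add: fun_eq_iff \<open>inv T = S\<close>)
  show "bij T"
    using S o_bij by blast
qed

lemma invertible_opI:
  assumes "bounded_clinear T" "bounded_clinear S" "\<And>x. S (T x) = x" "\<And>x. T (S x) = x"
  shows "invertible_op T"
  using assms by (auto simp: invertible_op_def fun_eq_iff)

lemma invertible_op_comp:
  assumes "invertible_op S" "invertible_op T"
  shows "invertible_op (\<lambda>x. S (T x))"
  by (rule invertible_opI[where S = "\<lambda>x. inv T (inv S x)"])
    (simp_all add: assms invertible_opD bounded_clinear_comp)

lemma invertible_op_scaleC:
  assumes "invertible_op T" "c \<noteq> 0"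
  shows "invertible_op (\<lambda>x. c *\<^sub>C T x)"
  by (rule invertible_opI[where S = "\<lambda>x. inv T (inverse c *\<^sub>C x)"])
    (simp_all add: assms invertible_opD bounded_clinear_comp bounded_clinear_intros scaleC_scaleC)

lemma invertible_op_uminus:
  assumes "invertible_op T"
  shows "invertible_op (\<lambda>x. - T x)"
  using invertible_op_scaleC[OF assms, of "-1"] by (simp add: scaleC_minus_left)

text \<open>In place of a Neumann series: solving \<open>x - B x = y\<close> means finding the fixed
  point of the contraction that sends \<open>x\<close> to \<open>y + B x\<close>.\<close>

lemma invertible_op_ident_minus:
  assumes B: "bounded_clinear B" and q: "q < 1" "\<And>x. norm (B x) \<le> q * norm x"
  shows "invertible_op (\<lambda>x. x - B x)"
proof -
  have B_diff: "B (x - y) = B x - B y" for x y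
    using B bounded_clinearD(4) by blast
  have low: "(1 - q) * norm x \<le> norm (x - B x)" for x
    using norm_triangle_ineq2[of x "B x"] q(2)[of x] by (simp add: algebra_simps)
  \<comment> \<open>A contraction constant has to be nonnegative, while \<open>q\<close> may be
    negative on the zero space.\<close>
  define p where "p = max 0 q"
  have p: "0 \<le> p" "p < 1" "norm (B x) \<le> p * norm x" for x
    using q order_trans[OF q(2) mult_right_mono[of q p "norm x"]] by (auto simp: p_def)
  have "\<exists>!x. y + B x = x" for y
    by (rule banach_fix_type[OF p(1,2)])
      (use p(3) in \<open>simp add: dist_norm flip: B_diff\<close>)
  then have "\<exists>x. x - B x = y" for y
    by (metis add_diff_cancel_right')
  then obtain S where S: "\<And>y. S y - B (S y) = y"
    by metis
  have inj: "x = y" if "x - B x = y - B y" for x y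
  proof -
    have "(x - y) - B (x - y) = 0"
      using that by (simp add: B_diff algebra_simps)
    then have "(1 - q) * norm (x - y) \<le> 0"
      using low[of "x - y"] by simp
    then show ?thesis
      using q(1) by (simp add: mult_le_0_iff)
  qed
  have "bounded_clinear S"
  proof (rule bounded_clinearI)
    show "S (x + y) = S x + S y" for x y
      by (rule inj) (use S in \<open>simp add: bounded_clinearD[OF B] add_diff_add\<close>)
    show "S (c *\<^sub>C x) = c *\<^sub>C S x" for c x
      by (rule inj) (use S in \<open>simp add: bounded_clinearD[OF B] flip: scaleC_diff_right\<close>)
    show "norm (S x) \<le> 1 / (1 - q) * norm x" for x
      using low[of "S x"] q(1) by (simp add: S field_simps)
  qed
  then show ?thesis
    by (rule invertible_opI[OF bounded_clinear_diff[OF bounded_clinear_ident B]])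
      (rule inj, (rule S)+)
qed

section \<open>Symmetric operators\<close>

definition symmetric_op :: "('a::complex_hilbert \<Rightarrow> 'a) \<Rightarrow> bool" where
  "symmetric_op A \<longleftrightarrow> (\<forall>x y. cinner (A x) y = cinner x (A y))"

lemma symmetric_opD: "symmetric_op A \<Longrightarrow> cinner (A x) y = cinner x (A y)"
  by (simp add: symmetric_op_def)

lemma adj_symmetric: "symmetric_op A \<Longrightarrow> adj A = A"
  by (rule adj_eqI) (rule symmetric_opD)

lemma Im_symmetric_op:
  assumes "symmetric_op A"
  shows "Im (cinner (A x) x) = 0"
proof -
  have "cinner (A x) x = cnj (cinner (A x) x)"
    by (metis assms cinner_commute symmetric_opD)
  then show ?thesis
    by (metis cnj.simps(2) complex_surj equal_neg_zero)
qed

text \<open>Symmetry makes the quadratic form real, which leaves only its sign to check.\<close>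

lemma positive_op_iff:
  assumes "bounded_clinear A" "symmetric_op A"
  shows "positive_op A \<longleftrightarrow> (\<forall>x. 0 \<le> Re (cinner (A x) x))"
  using assms by (simp add: positive_op_def complex_nonneg_Reals_iff Im_symmetric_op)

lemma norm_diff_scaleR_square:
  "(norm (A x - t *\<^sub>R x))\<^sup>2 = (norm (A x))\<^sup>2 - 2 * t * Re (cinner (A x) x) + t\<^sup>2 * (norm x)\<^sup>2"
  for A :: "'a::complex_hilbert \<Rightarrow> 'a"
  by (simp add: norm_diff_square cinner_simps power_mult_distrib)

text \<open>
  With \<open>L = c - K\<close>, the identity \<open>c K L = K L K + L K L\<close> exhibits \<open>K (c - K)\<close> as positive.
\<close>

lemma symmetric_op_square_le:
  assumes K: "bounded_clinear K" "symmetric_op K"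
    and nonneg: "\<And>x. 0 \<le> Re (cinner (K x) x)"
    and le: "\<And>x. Re (cinner (K x) x) \<le> c * (norm x)\<^sup>2"
  shows "(norm (K x))\<^sup>2 \<le> c * Re (cinner (K x) x)"
proof -
  note lin = bounded_clinearD[OF K(1)]
  define a b d where "a = Re (cinner (K x) x)" and "b = (norm (K x))\<^sup>2"
    and "d = Re (cinner (K (K x)) (K x))"
  have d: "d \<le> c * b"
    using le[of "K x"] by (simp add: d_def b_def)
  have K3: "Re (cinner (K (K x)) x) = b" "Re (cinner (K x) (K x)) = b"
    using symmetric_opD[OF K(2), of "K x" x] by (simp_all add: Re_cinner_self b_def)
  \<comment> \<open>This is the form of \<open>L K L\<close>; the form of \<open>K L K\<close> is
    nonnegative by \<open>d\<close>.\<close>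
  have "0 \<le> Re (cinner (K (c *\<^sub>R x - K x)) (c *\<^sub>R x - K x))"
    by (rule nonneg)
  also have "\<dots> = c\<^sup>2 * a - 2 * c * b + d"
    by (simp add: lin cinner_simps K3 a_def d_def power2_eq_square algebra_simps)
  finally have pos: "0 \<le> c * (c * a - b)"
    using d by (simp add: power2_eq_square algebra_simps)
  show ?thesis
  proof (cases "0 < c")
    case True
    then show ?thesis
      using pos by (simp add: a_def b_def zero_le_mult_iff)
  next
    case False
    then have le0: "c * (norm y)\<^sup>2 \<le> 0" for y :: 'a
      by (simp add: mult_le_0_iff)
    \<comment> \<open>A nonpositive \<open>c\<close> cannot be cancelled. Here the form vanishes at
      \<open>x\<close> and at \<open>K x\<close>, so its value at \<open>x - K x\<close> is
      \<open>- 2 * b\<close>, which forces \<open>K x = 0\<close>.\<close>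
    have "a = 0" "d = 0"
      using le[of x] nonneg[of x] le0[of x] le[of "K x"] nonneg[of "K x"] le0[of "K x"]
      by (auto simp: a_def d_def)
    moreover have "0 \<le> Re (cinner (K (x - t *\<^sub>R K x)) (x - t *\<^sub>R K x))" for t
      by (rule nonneg)
    ultimately have "b \<le> 0"
      by (elim meta_allE[of _ 1]) (simp add: lin cinner_simps K3 flip: a_def d_def)
    then show ?thesis
      using \<open>a = 0\<close> by (simp add: a_def b_def)
  qed
qed

lemma symmetric_op_norm_le:
  assumes K: "bounded_clinear K" "symmetric_op K"
    and "\<And>x. 0 \<le> Re (cinner (K x) x)" "\<And>x. Re (cinner (K x) x) \<le> c * (norm x)\<^sup>2" "0 \<le> c"
  shows "norm (K x) \<le> c * norm x"
proof -
  have "(norm (K x))\<^sup>2 \<le> c * Re (cinner (K x) x)"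
    by (rule symmetric_op_square_le) fact+
  also have "\<dots> \<le> c * (c * (norm x)\<^sup>2)"
    using assms by (intro mult_left_mono) auto
  finally have "(norm (K x))\<^sup>2 \<le> (c * norm x)\<^sup>2"
    by (simp add: power2_eq_square mult_ac)
  then show ?thesis
    by (rule power2_le_imp_le) (use \<open>0 \<le> c\<close> in simp)
qed

text \<open>
  Completing the square, the quadratic inequality on the left says that \<open>A\<close> is within
  \<open>(b - a)/2\<close> of the scalar \<open>(a + b)/2\<close>.
\<close>

lemma symmetric_op_between_iff:
  assumes A: "bounded_clinear A" "symmetric_op A" and "a \<le> b"
  shows "(\<forall>x. 0 \<le> (a + b) * Re (cinner (A x) x) - (norm (A x))\<^sup>2 - a * b * (norm x)\<^sup>2) \<longleftrightarrow>
    (\<forall>x. a * (norm x)\<^sup>2 \<le> Re (cinner (A x) x) \<and> Re (cinner (A x) x) \<le> b * (norm x)\<^sup>2)"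
    (is "?L \<longleftrightarrow> ?R")
proof (intro iffI allI)
  fix x
  assume ?L
  define m h where "m = (a + b) / 2" and "h = (b - a) / 2"
  have "(norm (A x - m *\<^sub>R x))\<^sup>2 \<le> (h * norm x)\<^sup>2"
    using \<open>?L\<close>[rule_format, of x] norm_diff_scaleR_square[of A x m]
    by (simp add: m_def h_def power_mult_distrib power2_eq_square field_simps)
  then have *: "norm (A x - m *\<^sub>R x) \<le> h * norm x"
    by (rule power2_le_imp_le) (use \<open>a \<le> b\<close> in \<open>simp add: h_def\<close>)
  have mh: "m * (norm x)\<^sup>2 - h * (norm x)\<^sup>2 = a * (norm x)\<^sup>2"
    "m * (norm x)\<^sup>2 + h * (norm x)\<^sup>2 = b * (norm x)\<^sup>2"
    by (simp_all add: m_def h_def field_simps)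
  have sq: "norm (A x - m *\<^sub>R x) * norm x \<le> h * (norm x)\<^sup>2"
    using mult_right_mono[OF *, of "norm x"] by (simp add: power2_eq_square mult_ac)
  have "\<bar>Re (cinner (A x - m *\<^sub>R x) x)\<bar> \<le> norm (A x - m *\<^sub>R x) * norm x"
    using abs_Re_le_cmod cmod_cinner_le order_trans by blast
  then have "\<bar>Re (cinner (A x) x) - m * (norm x)\<^sup>2\<bar> \<le> h * (norm x)\<^sup>2"
    using sq by (simp add: cinner_simps Re_cinner_self)
  then show "a * (norm x)\<^sup>2 \<le> Re (cinner (A x) x) \<and> Re (cinner (A x) x) \<le> b * (norm x)\<^sup>2"
    unfolding abs_le_iff using mh by linarith
next
  fix x
  assume ?R
  \<comment> \<open>The shift turns the bounds into \<open>0 \<le> K \<le> b - a\<close>; expanding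
    the resulting square inequality gives the claim.\<close>
  define K where "K x = A x - a *\<^sub>R x" for x
  have form: "Re (cinner (K x) x) = Re (cinner (A x) x) - a * (norm x)\<^sup>2" for x
    by (simp add: K_def cinner_simps Re_cinner_self)
  have "(norm (K x))\<^sup>2 \<le> (b - a) * Re (cinner (K x) x)"
  proof (rule symmetric_op_square_le)
    show "bounded_clinear K"
      unfolding K_def by (intro bounded_clinear_intros A)
    show "symmetric_op K"
      using A(2) by (simp add: symmetric_op_def K_def cinner_simps)
    show "0 \<le> Re (cinner (K x) x)" "Re (cinner (K x) x) \<le> (b - a) * (norm x)\<^sup>2" for x
      using \<open>?R\<close>[rule_format, of x] by (simp_all add: form algebra_simps)
  qed
  then show "0 \<le> (a + b) * Re (cinner (A x) x) - (norm (A x))\<^sup>2 - a * b * (norm x)\<^sup>2"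
    using norm_diff_scaleR_square[of A x a]
    by (simp add: form flip: K_def) (simp add: power2_eq_square algebra_simps)
qed

section \<open>Square roots\<close>

text \<open>
  For \<open>A = s (1 - B)\<close> with \<open>\<parallel>B\<parallel> \<le> q < 1\<close> the root is \<open>sqrt s (1 - Y)\<close>, where \<open>Y\<close> is the fixed
  point of the contraction \<open>Y \<mapsto> (B + Y\<^sup>2)/2\<close>. Carrying symmetry and commutation with the commutant
  of \<open>A\<close> in the invariant closed set gives these properties of \<open>Y\<close> for free.
\<close>

lemma sqrt_fixed_point:
  fixes B :: "'a::complex_hilbert \<Rightarrow> 'a"
  assumes B: "bounded_clinear B" "symmetric_op B" and q: "0 \<le> q" "q < 1" "\<And>x. norm (B x) \<le> q * norm x"
  obtains Y where "bounded_clinear Y" "symmetric_op Y" "\<And>x. norm (Y x) \<le> q * norm x"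
    "\<And>x. 2 *\<^sub>R Y x = B x + Y (Y x)"
    "\<forall>Q. bounded_clinear Q \<longrightarrow> (\<forall>x. B (Q x) = Q (B x)) \<longrightarrow> (\<forall>x. Y (Q x) = Q (Y x))"
proof -
  define B' where "B' = Blinfun B"
  have B': "blinfun_apply B' = B"
    unfolding B'_def using bounded_clinearD(1)[OF B(1)] by (rule bounded_linear_Blinfun_apply)
  have nB: "norm B' \<le> q"
    by (rule norm_blinfun_bound) (use q in \<open>simp_all add: B'\<close>)
  define comm where "comm = {Q. bounded_clinear Q \<and> (\<forall>x. B (Q x) = Q (B x))}"
  \<comment> \<open>The iteration runs in the Banach space of bounded real-linear maps, so complex
    homogeneity is one of the closed conditions. The ball of radius \<open>q\<close> is invariant
    because \<open>(q + q\<^sup>2) / 2 \<le> q\<close>.\<close>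
  define S :: "('a \<Rightarrow>\<^sub>L 'a) set" where
    "S = {Y. norm Y \<le> q} \<inter> {Y. \<forall>c x. blinfun_apply Y (c *\<^sub>C x) = c *\<^sub>C Y x} \<inter>
      {Y. \<forall>x y. cinner (blinfun_apply Y x) y = cinner x (Y y)} \<inter>
      {Y. \<forall>Q\<in>comm. \<forall>x. blinfun_apply Y (Q x) = Q (Y x)}"
  define F where "F Y = (1/2) *\<^sub>R (B' + (Y o\<^sub>L Y))" for Y
  have F_apply: "F Y x = (1/2) *\<^sub>R (B x + Y (Y x))" for Y x
    by (simp add: F_def blinfun.bilinear_simps B')
  have cont: "continuous_on UNIV (\<lambda>Y. f (blinfun_apply Y x))" if "bounded_linear f"
    for f :: "'a \<Rightarrow> 'c::real_normed_vector" and x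
    by (intro bounded_linear.continuous_on[OF that] continuous_intros)
  have "closed S"
    unfolding S_def
  proof (intro closed_Int)
    show "closed {Y :: 'a \<Rightarrow>\<^sub>L 'a. norm Y \<le> q}"
      by (intro closed_Collect_le continuous_intros)
    show "closed {Y :: 'a \<Rightarrow>\<^sub>L 'a. \<forall>c x. Y (c *\<^sub>C x) = c *\<^sub>C Y x}"
      by (intro closed_Collect_all closed_Collect_eq cont bounded_linear_scaleC continuous_intros)
    show "closed {Y :: 'a \<Rightarrow>\<^sub>L 'a. \<forall>x y. cinner (Y x) y = cinner x (Y y)}"
      by (intro closed_Collect_all closed_Collect_eq cont bounded_linear_cinner_left
          bounded_linear_cinner_right)
    have "closed {Y :: 'a \<Rightarrow>\<^sub>L 'a. Y (Q x) = Q (Y x)}" if "Q \<in> comm" for Q x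
    proof (intro closed_Collect_eq)
      show "continuous_on UNIV (\<lambda>Y :: 'a \<Rightarrow>\<^sub>L 'a. Q (Y x))"
        using that by (intro cont) (auto simp: comm_def bounded_clinear_def)
    qed (intro continuous_intros)
    then have "closed (\<Inter>Q\<in>comm. \<Inter>x. {Y :: 'a \<Rightarrow>\<^sub>L 'a. Y (Q x) = Q (Y x)})"
      by (intro closed_INT ballI)
    also have "(\<Inter>Q\<in>comm. \<Inter>x. {Y :: 'a \<Rightarrow>\<^sub>L 'a. Y (Q x) = Q (Y x)}) =
        {Y. \<forall>Q\<in>comm. \<forall>x. blinfun_apply Y (Q x) = Q (Y x)}"
      by auto
    finally show "closed {Y :: 'a \<Rightarrow>\<^sub>L 'a. \<forall>Q\<in>comm. \<forall>x. Y (Q x) = Q (Y x)}" .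
  qed
  have "F Y \<in> S" if "Y \<in> S" for Y
  proof -
    have Y: "norm Y \<le> q" "\<And>c x. Y (c *\<^sub>C x) = c *\<^sub>C Y x"
      "\<And>x y. cinner (Y x) y = cinner x (Y y)" "\<And>Q x. Q \<in> comm \<Longrightarrow> Y (Q x) = Q (Y x)"
      using that by (auto simp: S_def)
    have "norm (Y o\<^sub>L Y) \<le> norm Y * norm Y"
      by (rule norm_blinfun_compose)
    also have "\<dots> \<le> q * 1"
      using Y(1) q by (intro mult_mono) auto
    finally have "norm (B' + (Y o\<^sub>L Y)) \<le> 2 * q"
      using nB norm_triangle_ineq[of B' "Y o\<^sub>L Y"] by linarith
    then have "norm (F Y) \<le> q"
      by (simp add: F_def)
    moreover have "F Y (c *\<^sub>C x) = c *\<^sub>C F Y x" for c x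
      by (simp add: F_apply Y bounded_clinearD(2)[OF B(1)] scaleC_scaleR_commute
          flip: scaleC_add_right)
    moreover have "cinner (F Y x) y = cinner x (F Y y)" for x y
      by (simp add: F_apply cinner_simps Y symmetric_opD[OF B(2)])
    moreover have "F Y (Q x) = Q (F Y x)" if "Q \<in> comm" for Q x
      using that by (simp add: F_apply Y(4)) (simp add: comm_def bounded_clinearD)
    ultimately show ?thesis
      by (auto simp: S_def)
  qed
  moreover have "dist (F Y) (F Z) \<le> q * dist Y Z" if "Y \<in> S" "Z \<in> S" for Y Z
  proof -
    have n: "norm Y \<le> q" "norm Z \<le> q"
      using that by (auto simp: S_def)
    \<comment> \<open>The difference of two squares is split without commuting \<open>Y\<close> and
      \<open>Z\<close>; each summand has norm at most \<open>q * norm (Y - Z)\<close>.\<close>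
    have "F Y - F Z = (1/2) *\<^sub>R ((Y o\<^sub>L (Y - Z)) + ((Y - Z) o\<^sub>L Z))"
      by (rule blinfun_eqI) (simp add: F_apply blinfun.bilinear_simps algebra_simps)
    moreover have "norm (Y o\<^sub>L (Y - Z)) \<le> q * norm (Y - Z)"
      by (rule order_trans[OF norm_blinfun_compose]) (use n in \<open>simp add: mult_right_mono\<close>)
    moreover have "norm ((Y - Z) o\<^sub>L Z) \<le> q * norm (Y - Z)"
      by (rule order_trans[OF norm_blinfun_compose])
        (use n in \<open>simp add: mult.commute mult_right_mono\<close>)
    ultimately show ?thesis
      using norm_triangle_ineq[of "Y o\<^sub>L (Y - Z)" "(Y - Z) o\<^sub>L Z"] by (simp add: dist_norm)
  qed
  moreover have "0 \<in> S"
    using q by (auto simp: S_def comm_def bounded_clinearD)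
  ultimately have "\<exists>!Y\<in>S. F Y = Y"
    using q \<open>closed S\<close> by (intro Banach_fix) (auto simp: complete_eq_closed)
  then obtain Y where Y: "Y \<in> S" "F Y = Y"
    by blast
  show thesis
  proof
    show "bounded_clinear (blinfun_apply Y)" "symmetric_op (blinfun_apply Y)"
      using Y(1) blinfun.bounded_linear_right
      by (auto simp: S_def bounded_clinear_def symmetric_op_def)
    show "norm (Y x) \<le> q * norm x" for x
      using norm_blinfun[of Y x] Y(1) mult_right_mono[of "norm Y" q "norm x"] by (auto simp: S_def)
    show "2 *\<^sub>R Y x = B x + Y (Y x)" for x
    proof -
      have "2 *\<^sub>R F Y x = B x + Y (Y x)"
        unfolding F_apply by simp
      then show ?thesis
        by (simp add: Y(2))
    qed
    show "\<forall>Q. bounded_clinear Q \<longrightarrow> (\<forall>x. B (Q x) = Q (B x)) \<longrightarrow> (\<forall>x. Y (Q x) = Q (Y x))"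
      using Y(1) by (auto simp: S_def comm_def)
  qed
qed

text \<open>The strict lower bound \<open>e\<close> and the commutation with everything that
  commutes with \<open>A\<close> are returned along with the root because uniqueness rests on
  them.\<close>

lemma sqrt_op_exists:
  fixes A :: "'a::complex_hilbert \<Rightarrow> 'a"
  assumes A: "bounded_clinear A" "symmetric_op A"
    and c: "0 < c" "\<And>x. c * (norm x)\<^sup>2 \<le> Re (cinner (A x) x)"
  obtains P e where "bounded_clinear P" "symmetric_op P" "0 < e"
    "\<And>x. e * (norm x)\<^sup>2 \<le> Re (cinner (P x) x)" "\<And>x. P (P x) = A x"
    "\<forall>Q. bounded_clinear Q \<longrightarrow> (\<forall>x. A (Q x) = Q (A x)) \<longrightarrow> (\<forall>x. P (Q x) = Q (P x))"
proof -
  obtain k where k: "0 < k" "\<And>x. norm (A x) \<le> k * norm x"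
    using bounded_clinear_bound[OF A(1)] by metis
  \<comment> \<open>Scaling by an upper bound of \<open>A\<close> gives
    \<open>0 \<le> B \<le> 1 - c / s\<close>. The maximum ensures \<open>c \<le> s\<close>, hence
    \<open>0 \<le> q\<close>, also on the zero space, where \<open>k < c\<close> is
    possible.\<close>
  define s where "s = max k c"
  have s: "0 < s" "k \<le> s" "c \<le> s"
    using k by (auto simp: s_def)
  have A_le: "Re (cinner (A x) x) \<le> s * (norm x)\<^sup>2" for x
  proof -
    have "Re (cinner (A x) x) \<le> norm (A x) * norm x"
      by (rule Re_cinner_le)
    also have "\<dots> \<le> (s * norm x) * norm x"
      using k(2)[of x] mult_right_mono[OF s(2), of "norm x"] by (intro mult_right_mono) auto
    finally show ?thesis
      by (simp add: power2_eq_square)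
  qed
  define B where "B x = x - (1/s) *\<^sub>R A x" for x
  define q where "q = 1 - c / s"
  have q: "0 \<le> q" "q < 1"
    using s c by (auto simp: q_def)
  have B: "bounded_clinear B" "symmetric_op B"
  proof -
    show "bounded_clinear B"
      unfolding B_def by (intro bounded_clinear_intros A)
    show "symmetric_op B"
      using A(2) by (simp add: symmetric_op_def B_def cinner_simps)
  qed
  have "norm (B x) \<le> q * norm x" for x
  proof (rule symmetric_op_norm_le[OF B _ _ q(1)])
    have form: "Re (cinner (B x) x) = (norm x)\<^sup>2 - Re (cinner (A x) x) / s" for x
      by (simp add: B_def cinner_simps Re_cinner_self)
    show "0 \<le> Re (cinner (B x) x)" "Re (cinner (B x) x) \<le> q * (norm x)\<^sup>2" for x
      using A_le[of x] c(2)[of x] s by (simp_all add: form q_def field_simps)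
  qed
  then obtain Y where Y: "bounded_clinear Y" "symmetric_op Y" "\<And>x. norm (Y x) \<le> q * norm x"
    "\<And>x. 2 *\<^sub>R Y x = B x + Y (Y x)"
    "\<forall>Q. bounded_clinear Q \<longrightarrow> (\<forall>x. B (Q x) = Q (B x)) \<longrightarrow> (\<forall>x. Y (Q x) = Q (Y x))"
    by (rule sqrt_fixed_point[OF B q]) (rule that)
  define P where "P x = sqrt s *\<^sub>R (x - Y x)" for x
  show thesis
  proof
    show "bounded_clinear P"
      unfolding P_def by (intro bounded_clinear_intros Y)
    show "symmetric_op P"
      using Y(2) by (simp add: symmetric_op_def P_def cinner_simps)
    show "0 < sqrt s * (1 - q)"
      using s q by simp
    show "sqrt s * (1 - q) * (norm x)\<^sup>2 \<le> Re (cinner (P x) x)" for x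
    proof -
      have "Re (cinner (Y x) x) \<le> norm (Y x) * norm x"
        by (rule Re_cinner_le)
      also have "\<dots> \<le> q * norm x * norm x"
        using Y(3) by (intro mult_right_mono) auto
      finally have "sqrt s * ((1 - q) * (norm x)\<^sup>2) \<le> sqrt s * ((norm x)\<^sup>2 - Re (cinner (Y x) x))"
        using s by (intro mult_left_mono) (auto simp: power2_eq_square algebra_simps)
      then show ?thesis
        by (simp add: P_def cinner_simps Re_cinner_self mult.assoc)
    qed
    \<comment> \<open>By the fixed point equation,
      \<open>(1 - Y)\<^sup>2 = 1 - 2 Y + Y\<^sup>2 = 1 - B\<close>, which is
      \<open>A / s\<close>.\<close>
    show "P (P x) = A x" for x
    proof -
      have "P (P x) = s *\<^sub>R (x - 2 *\<^sub>R Y x + Y (Y x))"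
        using s by (simp add: P_def bounded_clinearD[OF Y(1)] algebra_simps scaleR_2)
      then show ?thesis
        using s by (simp add: Y(4) B_def)
    qed
    show "\<forall>Q. bounded_clinear Q \<longrightarrow> (\<forall>x. A (Q x) = Q (A x)) \<longrightarrow> (\<forall>x. P (Q x) = Q (P x))"
    proof (intro allI impI)
      fix Q x
      assume Q: "bounded_clinear Q" "\<forall>x. A (Q x) = Q (A x)"
      have "B (Q x) = Q (B x)" for x
        by (simp add: B_def Q bounded_clinearD[OF Q(1)])
      then show "P (Q x) = Q (P x)"
        by (simp add: P_def Y(5) Q bounded_clinearD[OF Q(1)])
    qed
  qed
qed

text \<open>A positive root \<open>Q\<close> commutes with \<open>A = Q\<^sup>2\<close>, hence with
  \<open>P\<close>. Then \<open>(P + Q) (P - Q) = 0\<close>, and \<open>P + Q\<close> is bounded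
  below by \<open>e\<close>. So the description in \<open>sqrt_op\<close> has exactly one
  solution.\<close>

lemma sqrt_op_properties:
  assumes A: "bounded_clinear A" "symmetric_op A"
    and c: "0 < c" "\<And>x. c * (norm x)\<^sup>2 \<le> Re (cinner (A x) x)"
  shows "bounded_clinear (sqrt_op A)" "symmetric_op (sqrt_op A)" "sqrt_op A (sqrt_op A x) = A x"
    "0 \<le> Re (cinner (sqrt_op A x) x)"
proof -
  obtain P e where P: "bounded_clinear P" "symmetric_op P" "0 < e"
    "\<And>x. e * (norm x)\<^sup>2 \<le> Re (cinner (P x) x)" "\<And>x. P (P x) = A x"
    "\<forall>Q. bounded_clinear Q \<longrightarrow> (\<forall>x. A (Q x) = Q (A x)) \<longrightarrow> (\<forall>x. P (Q x) = Q (P x))"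
    by (rule sqrt_op_exists[OF A c]) (rule that)
  have nonneg: "0 \<le> Re (cinner (P x) x)" for x
    using P(3) P(4)[of x] order_trans[of 0 "e * (norm x)\<^sup>2"] by simp
  have "sqrt_op A = P"
    unfolding sqrt_op_def
  proof (rule the_equality)
    show "positive_op P \<and> P \<circ> P = A"
      using nonneg by (simp add: positive_op_iff P fun_eq_iff)
    fix Q
    assume Q: "positive_op Q \<and> Q \<circ> Q = A"
    then have QQ: "Q (Q x) = A x" and bQ: "bounded_clinear Q" and
      posQ: "0 \<le> Re (cinner (Q x) x)" for x
      by (auto simp: positive_op_def complex_nonneg_Reals_iff)
    have comm: "P (Q x) = Q (P x)" for x
      using P(6) bQ by (simp flip: QQ)
    have "Q x = P x" for x
    proof -
      define y where "y = P x - Q x"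
      have "P y + Q y = 0"
        by (simp add: y_def bounded_clinearD[OF bQ] bounded_clinearD[OF P(1)] P(5) QQ comm)
      then have "Re (cinner (P y) y) + Re (cinner (Q y) y) = 0"
        by (metis cinner_add_left cinner_zero_left plus_complex.simps(1) zero_complex.simps(1))
      then have "e * (norm y)\<^sup>2 \<le> 0"
        using P(4)[of y] posQ[of y] by linarith
      then show ?thesis
        using P(3) by (simp add: mult_le_0_iff y_def)
    qed
    then show "Q = P"
      by blast
  qed
  then show "bounded_clinear (sqrt_op A)" "symmetric_op (sqrt_op A)" "sqrt_op A (sqrt_op A x) = A x"
    "0 \<le> Re (cinner (sqrt_op A x) x)"
    using P nonneg by simp_all
qed

section \<open>Polynomials in an operator\<close>

text \<open>Padding with zero coefficients avoids a case distinction at \<open>pCons a 0\<close>,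
  where the degree does not grow.\<close>

lemma poly_op_eq_sum:
  assumes "degree p \<le> n"
  shows "poly_op p T x = (\<Sum>i\<le>n. coeff p i *\<^sub>C (T ^^ i) x)"
  unfolding poly_op_def
  by (rule sum.mono_neutral_left) (use assms in \<open>auto simp: coeff_eq_0\<close>)

lemma poly_op_0 [simp]: "poly_op 0 T x = 0"
  by (simp add: poly_op_def)

text \<open>The Horner step, on which the inductions for sums, scalar multiples and products
  rest.\<close>

lemma poly_op_pCons:
  assumes T: "bounded_clinear T"
  shows "poly_op (pCons a p) T x = a *\<^sub>C x + T (poly_op p T x)"
proof -
  note lin = bounded_linear.linear[OF bounded_clinearD(1)[OF T]]
  have "poly_op (pCons a p) T x = (\<Sum>i\<le>Suc (degree p). coeff (pCons a p) i *\<^sub>C (T ^^ i) x)"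
    by (rule poly_op_eq_sum) (simp add: degree_pCons_le)
  also have "\<dots> = a *\<^sub>C x + (\<Sum>i\<le>degree p. coeff p i *\<^sub>C T ((T ^^ i) x))"
    by (simp add: sum.atMost_Suc_shift del: sum.atMost_Suc)
  also have "(\<Sum>i\<le>degree p. coeff p i *\<^sub>C T ((T ^^ i) x)) = T (poly_op p T x)"
    by (simp add: poly_op_def linear_sum[OF lin] bounded_clinearD(2)[OF T])
  finally show ?thesis .
qed

lemma bounded_clinear_poly_op:
  assumes T: "bounded_clinear T"
  shows "bounded_clinear (poly_op p T)"
proof (induction p)
  case 0
  have "bounded_clinear (\<lambda>x::'a. 0)"
    by (rule bounded_clinearI[of _ 0])
      simp_all
  then show ?case
    by (simp add: poly_op_def)
next
  case (pCons a p)
  have "poly_op (pCons a p) T = (\<lambda>x. a *\<^sub>C x + T (poly_op p T x))"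
    using poly_op_pCons[OF T] by blast
  then show ?case
    using pCons T by (simp add: bounded_clinear_comp bounded_clinear_intros)
qed

lemma poly_op_add:
  assumes T: "bounded_clinear T"
  shows "poly_op (p + q) T x = poly_op p T x + poly_op q T x"
  by (induction p q rule: poly_induct2)
    (simp_all add: poly_op_pCons[OF T] bounded_clinearD[OF T] scaleC_add_left)

lemma poly_op_smult:
  assumes T: "bounded_clinear T"
  shows "poly_op (smult c p) T x = c *\<^sub>C poly_op p T x"
  by (induction p)
    (simp_all add: poly_op_pCons[OF T] bounded_clinearD[OF T] scaleC_add_right scaleC_scaleC)

lemma poly_op_diff:
  assumes T: "bounded_clinear T"
  shows "poly_op (p - q) T x = poly_op p T x - poly_op q T x"
  using poly_op_add[OF T, of p "smult (-1) q"] poly_op_smult[OF T, of "-1" q]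
  by (simp add: scaleC_minus_left)

lemma poly_op_mult:
  assumes T: "bounded_clinear T"
  shows "poly_op (p * q) T x = poly_op p T (poly_op q T x)"
  by (induction p)
    (simp_all add: poly_op_pCons[OF T] poly_op_add[OF T] poly_op_smult[OF T] bounded_clinearD[OF T])

lemma poly_op_const: "bounded_clinear T \<Longrightarrow> poly_op [:c:] T x = c *\<^sub>C x"
  by (simp add: poly_op_pCons bounded_clinearD)

lemma poly_op_X: "bounded_clinear T \<Longrightarrow> poly_op [:0, 1:] T x = T x"
  by (simp add: poly_op_pCons bounded_clinearD)

lemma poly_op_linear: "bounded_clinear T \<Longrightarrow> poly_op [:- c, 1:] T x = T x - c *\<^sub>C x"
  by (simp add: poly_op_pCons bounded_clinearD scaleC_minus_left)

lemma cinner_poly_op: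
  assumes T: "bounded_clinear T" "symmetric_op T"
  shows "cinner (poly_op p T x) y = cinner x (poly_op (map_poly cnj p) T y)"
proof (induction p arbitrary: y)
  case (pCons a p)
  have "map_poly cnj (pCons a p) = pCons (cnj a) (map_poly cnj p)"
    by (rule map_poly_pCons) auto
  \<comment> \<open>\<open>T\<close> is the value of the polynomial \<open>[:0, 1:]\<close>, so it
    commutes with polynomials in \<open>T\<close> because polynomial multiplication is
    commutative.\<close>
  moreover have "poly_op (map_poly cnj p) T (T y) = T (poly_op (map_poly cnj p) T y)"
    using poly_op_mult[OF T(1), of "map_poly cnj p" "[:0, 1:]" y]
      poly_op_mult[OF T(1), of "[:0, 1:]" "map_poly cnj p" y]
    by (simp add: poly_op_X[OF T(1)] mult.commute)
  ultimately show ?case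
    by (simp add: poly_op_pCons[OF T(1)] cinner_simps symmetric_opD[OF T(2)] pCons)
qed simp

section \<open>Factoring polynomials into linear terms\<close>

lemma complex_poly_root_induct [consumes 1, case_names const root]:
  fixes p :: "complex poly"
  assumes "p \<noteq> 0"
    and const: "\<And>c. c \<noteq> 0 \<Longrightarrow> P [:c:]"
    and root: "\<And>a p. p \<noteq> 0 \<Longrightarrow> P p \<Longrightarrow> P ([:- a, 1:] * p)"
  shows "P p"
  using \<open>p \<noteq> 0\<close>
proof (induction "degree p" arbitrary: p)
  case 0
  then show ?case
    using const by (metis degree_eq_zeroE pCons_0_0)
next
  case (Suc n)
  then obtain a where "poly p a = 0"
    using fundamental_theorem_of_algebra[of p] by (auto simp: constant_degree)
  then obtain q where q: "p = [:- a, 1:] * q"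
    by (metis dvdE poly_eq_0_iff_dvd)
  then have "q \<noteq> 0"
    using Suc.prems by auto
  then have "degree p = Suc (degree q)"
    unfolding q by (subst degree_mult_eq) auto
  then show ?case
    using Suc.hyps \<open>q \<noteq> 0\<close> root q by simp
qed

text \<open>One half of the spectral mapping theorem: every linear factor is invertible, hence so is
  their product.\<close>

lemma invertible_poly_op:
  assumes T: "bounded_clinear T" and "p \<noteq> 0"
    and roots: "\<And>z. poly p z = 0 \<Longrightarrow> z \<notin> spectrum T"
  shows "invertible_op (poly_op p T)"
  using \<open>p \<noteq> 0\<close> roots
proof (induction rule: complex_poly_root_induct)
  case (const c)
  have "invertible_op (\<lambda>x. c *\<^sub>C x)"
    using const by (intro invertible_op_scaleC invertible_opI[where S = "\<lambda>x. x"] bounded_clinear_ident)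
      auto
  moreover have "poly_op [:c:] T = (\<lambda>x. c *\<^sub>C x)"
    using poly_op_const[OF T] by blast
  ultimately show ?case
    by simp
next
  case (root a p)
  have "invertible_op (\<lambda>x. - (a *\<^sub>C x - T x))"
    using root(3)[of a] by (intro invertible_op_uminus) (simp add: spectrum_def)
  then have "invertible_op (\<lambda>x. T x - a *\<^sub>C x)"
    by simp
  moreover have "invertible_op (poly_op p T)"
    using root by simp
  moreover have "poly_op ([:- a, 1:] * p) T = (\<lambda>x. (\<lambda>x. T x - a *\<^sub>C x) (poly_op p T x))"
    by (simp add: fun_eq_iff poly_op_mult[OF T] poly_op_linear[OF T] del: mult_pCons_left)
  ultimately show ?case
    using invertible_op_comp[of "\<lambda>x. T x - a *\<^sub>C x" "poly_op p T"] by simp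
qed

text \<open>Lower bounds of the linear factors multiply. Read contrapositively, this finds a root
  \<open>z\<close> of \<open>p\<close> for which \<open>T - z\<close> is not bounded below.\<close>

lemma poly_op_bounded_below:
  assumes T: "bounded_clinear T" and "p \<noteq> 0"
    and roots: "\<And>z. poly p z = 0 \<Longrightarrow> \<exists>d>0. \<forall>x. d * norm x \<le> norm (T x - z *\<^sub>C x)"
  shows "\<exists>d>0. \<forall>x. d * norm x \<le> norm (poly_op p T x)"
  using \<open>p \<noteq> 0\<close> roots
proof (induction rule: complex_poly_root_induct)
  case (const c)
  then show ?case
    by (intro exI[of _ "cmod c"]) (simp add: poly_op_const[OF T] norm_scaleC)
next
  case (root a p)
  have "poly ([:- a, 1:] * p) a = 0"
    by simp
  then obtain d where d: "0 < d" "\<And>x. d * norm x \<le> norm (T x - a *\<^sub>C x)"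
    using root(3) by blast
  have "poly ([:- a, 1:] * p) z = 0" if "poly p z = 0" for z
    using that by simp
  then obtain e where e: "0 < e" "\<And>x. e * norm x \<le> norm (poly_op p T x)"
    using root(2,3) by blast
  have "d * e * norm x \<le> norm (poly_op ([:- a, 1:] * p) T x)" for x
  proof -
    have "d * (e * norm x) \<le> d * norm (poly_op p T x)"
      using d(1) e(2) by (intro mult_left_mono) auto
    also have "\<dots> \<le> norm (poly_op ([:- a, 1:] * p) T x)"
      using d(2) by (simp add: poly_op_mult[OF T] poly_op_linear[OF T] del: mult_pCons_left)
    finally show ?thesis
      by (simp add: mult.assoc)
  qed
  then show ?case
    using d(1) e(1) by (intro exI[of _ "d * e"]) simp
qed

text \<open>On unit vectors the form of \<open>A - z\<close> stays away from \<open>0\<close>: its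
  imaginary part is \<open>- Im z\<close>, and its real part lies between \<open>a - Re z\<close>
  and \<open>b - Re z\<close>. Cauchy-Schwarz carries this over to the norm.\<close>

lemma symmetric_op_bounded_below:
  assumes A: "bounded_clinear A" "symmetric_op A"
    and between: "\<And>x. a * (norm x)\<^sup>2 \<le> Re (cinner (A x) x)" "\<And>x. Re (cinner (A x) x) \<le> b * (norm x)\<^sup>2"
    and z: "z \<notin> complex_of_real ` {a..b}"
  shows "\<exists>d>0. \<forall>x. d * norm x \<le> norm (A x - z *\<^sub>C x)"
proof -
  have key: "\<exists>d>0. \<forall>x. d * norm x \<le> norm (A x - z *\<^sub>C x)"
    if d: "0 < d" "\<And>x. d * (norm x)\<^sup>2 \<le> cmod (cinner (A x - z *\<^sub>C x) x)" for d
  proof (intro exI conjI allI)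
    fix x
    have "norm x * (d * norm x) \<le> norm x * norm (A x - z *\<^sub>C x)"
      using d(2)[of x] cmod_cinner_le[of "A x - z *\<^sub>C x" x]
      by (simp add: power2_eq_square mult_ac)
    then show "d * norm x \<le> norm (A x - z *\<^sub>C x)"
      by (cases "x = 0") auto
  qed (rule d)
  have form: "Re (cinner (A x - z *\<^sub>C x) x) = Re (cinner (A x) x) - Re z * (norm x)\<^sup>2"
    "Im (cinner (A x - z *\<^sub>C x) x) = - Im z * (norm x)\<^sup>2" for x
    by (simp_all add: cinner_simps cinner_self Im_symmetric_op[OF A(2)])
  consider "Im z \<noteq> 0" | "Re z < a" | "b < Re z"
    using z by (force simp: complex_eq_iff)
  then show ?thesis
  proof cases
    case 1
    have "\<bar>Im z\<bar> * (norm x)\<^sup>2 \<le> cmod (cinner (A x - z *\<^sub>C x) x)" for x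
      using abs_Im_le_cmod[of "cinner (A x - z *\<^sub>C x) x"] by (simp add: form abs_mult)
    then show ?thesis
      using 1 key[of "\<bar>Im z\<bar>"] by simp
  next
    case 2
    have "(a - Re z) * (norm x)\<^sup>2 \<le> cmod (cinner (A x - z *\<^sub>C x) x)" for x
      using complex_Re_le_cmod[of "cinner (A x - z *\<^sub>C x) x"] between(1)[of x]
      by (simp add: form left_diff_distrib)
    then show ?thesis
      using 2 key[of "a - Re z"] by simp
  next
    case 3
    have "(Re z - b) * (norm x)\<^sup>2 \<le> cmod (cinner (A x - z *\<^sub>C x) x)" for x
      using abs_Re_le_cmod[of "cinner (A x - z *\<^sub>C x) x"] between(2)[of x]
      by (simp add: form left_diff_distrib)
    then show ?thesis
      using 3 key[of "Re z - b"] by simp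
  qed
qed

text \<open>
  The infimum \<open>m\<close> of the quadratic form of \<open>h(A)\<close> on the unit sphere is an approximate eigenvalue,
  so \<open>A - z\<close> is not bounded below for some root \<open>z\<close> of \<open>h - m\<close>. Then \<open>z \<in> [a, b]\<close> and \<open>m = h(z)\<close>.
\<close>

lemma symmetric_op_poly_nonneg:
  assumes A: "bounded_clinear A" "symmetric_op A"
    and between: "\<And>x. a * (norm x)\<^sup>2 \<le> Re (cinner (A x) x)" "\<And>x. Re (cinner (A x) x) \<le> b * (norm x)\<^sup>2"
    and h: "\<And>t. a \<le> t \<Longrightarrow> t \<le> b \<Longrightarrow> 0 \<le> Re (poly h (of_real t))"
    and sym: "symmetric_op (poly_op h A)"
  shows "0 \<le> Re (cinner (poly_op h A x) x)"
proof (cases "x = 0")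
  case False
  define H where "H = poly_op h A"
  define \<phi> where "\<phi> x = Re (cinner (H x) x)" for x
  have H: "bounded_clinear H" "symmetric_op H"
    using sym A by (simp_all add: H_def bounded_clinear_poly_op)
  obtain k where k: "0 < k" "\<And>x. norm (H x) \<le> k * norm x"
    using bounded_clinear_bound[OF H(1)] by metis
  have \<phi>_abs: "\<bar>\<phi> x\<bar> \<le> k * (norm x)\<^sup>2" for x
  proof -
    have "\<bar>\<phi> x\<bar> \<le> norm (H x) * norm x"
      unfolding \<phi>_def using abs_Re_le_cmod cmod_cinner_le order_trans by blast
    also have "\<dots> \<le> k * norm x * norm x"
      using k by (intro mult_right_mono) auto
    finally show ?thesis
      by (simp add: power2_eq_square)
  qed
  define S where "S = \<phi> ` sphere 0 1"
  \<comment> \<open>The case \<open>x \<noteq> 0\<close> supplies a unit vector, without which the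
    infimum would be over the empty set.\<close>
  have "(1 / norm x) *\<^sub>R x \<in> sphere 0 1"
    using False by simp
  then have "S \<noteq> {}"
    unfolding S_def by blast
  have bdd: "bdd_below S"
  proof (rule bdd_belowI[of _ "- k"])
    show "- k \<le> s" if s: "s \<in> S" for s
    proof -
      obtain y where "norm y = 1" "s = \<phi> y"
        using s by (auto simp: S_def)
      then show ?thesis
        using \<phi>_abs[of y] by simp
    qed
  qed
  define m where "m = Inf S"
  have m_le: "m * (norm x)\<^sup>2 \<le> \<phi> x" for x
  proof (cases "x = 0")
    case False
    have "m \<le> \<phi> ((1 / norm x) *\<^sub>R x)"
      unfolding m_def using False by (intro cInf_lower bdd) (auto simp: S_def)
    also have "\<dots> = \<phi> x / (norm x)\<^sup>2"
      by (simp add: \<phi>_def bounded_clinearD[OF H(1)] cinner_simps power2_eq_square)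
    finally show ?thesis
      using False by (simp add: field_simps)
  qed (simp add: \<phi>_def)
  \<comment> \<open>If \<open>H - m\<close> were bounded below by \<open>d\<close>, the square
    inequality for the positive operator \<open>H - m\<close>, whose form is at most
    \<open>c = k + \<bar>m\<bar>\<close> on unit vectors, would raise the infimum to
    \<open>m + d\<^sup>2 / c\<close>.\<close>
  have not_below: "\<not> (\<forall>x. d * norm x \<le> norm (H x - m *\<^sub>R x))" if "0 < d" for d
  proof
    assume below: "\<forall>x. d * norm x \<le> norm (H x - m *\<^sub>R x)"
    define c where "c = k + \<bar>m\<bar>"
    have c: "0 < c"
      using k by (simp add: c_def)
    have form: "Re (cinner (H x - m *\<^sub>R x) x) = \<phi> x - m * (norm x)\<^sup>2" for x
      by (simp add: cinner_simps Re_cinner_self \<phi>_def)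
    have sq: "(norm (H x - m *\<^sub>R x))\<^sup>2 \<le> c * Re (cinner (H x - m *\<^sub>R x) x)" for x
    proof (rule symmetric_op_square_le)
      show "bounded_clinear (\<lambda>x. H x - m *\<^sub>R x)"
        by (intro bounded_clinear_intros H)
      show "symmetric_op (\<lambda>x. H x - m *\<^sub>R x)"
        using H(2) by (simp add: symmetric_op_def cinner_simps)
      show "0 \<le> Re (cinner (H x - m *\<^sub>R x) x)" for x
        using m_le[of x] by (simp add: form)
      show "Re (cinner (H x - m *\<^sub>R x) x) \<le> c * (norm x)\<^sup>2" for x
        using \<phi>_abs[of x] mult_right_mono[OF abs_ge_minus_self[of m], of "(norm x)\<^sup>2"]
        by (simp add: form c_def algebra_simps abs_le_iff)
    qed
    have "m + d\<^sup>2 / c \<le> s" if s: "s \<in> S" for s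
    proof -
      obtain x where x: "norm x = 1" "s = \<phi> x"
        using s by (auto simp: S_def)
      have "d\<^sup>2 \<le> (norm (H x - m *\<^sub>R x))\<^sup>2"
        using below[rule_format, of x] x \<open>0 < d\<close> by (intro power_mono) auto
      then show ?thesis
        using sq[of x] x c by (simp add: form field_simps)
    qed
    then have "m + d\<^sup>2 / c \<le> m"
      unfolding m_def using \<open>S \<noteq> {}\<close> by (intro cInf_greatest) auto
    then show False
      using c \<open>0 < d\<close> by (simp add: field_simps)
  qed
  define g where "g = h - [:complex_of_real m:]"
  have g: "poly_op g A x = H x - m *\<^sub>R x" for x
    by (simp add: g_def poly_op_diff[OF A(1)] poly_op_const[OF A(1)] H_def scaleC_of_real)
  have "0 \<le> m"
  proof (cases "g = 0")
    \<comment> \<open>For constant \<open>h = m\<close> no particular root is singled out;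
      \<open>m\<close> is the value of \<open>h\<close> at \<open>a\<close>, and the nonzero
      \<open>x\<close> ensures \<open>a \<le> b\<close>.\<close>
    case True
    then have *: "H x - m *\<^sub>R x = 0" for x
      using g[of x] by simp
    have "a \<le> b"
      using between[of x] False order_trans[OF between] by (simp add: mult_le_cancel_right)
    moreover have "h = [:complex_of_real m:]"
      using True by (simp add: g_def)
    ultimately show ?thesis
      using h[of a] by simp
  next
    case False
    then obtain z where z: "poly g z = 0" "z \<in> complex_of_real ` {a..b}"
      using poly_op_bounded_below[OF A(1), of g] symmetric_op_bounded_below[OF A between] not_below g
      by metis
    then obtain t where t: "z = of_real t" "a \<le> t" "t \<le> b"
      by auto
    have "poly h z = of_real m"
      using z(1) by (simp add: g_def)
    then show ?thesis
      using h[of t] t by simp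
  qed
  then have "0 \<le> m * (norm x)\<^sup>2"
    by simp
  then show ?thesis
    using m_le[of x] by (simp add: \<phi>_def H_def)
qed simp

lemma symmetric_op_poly_norm_le:
  assumes A: "bounded_clinear A" "symmetric_op A"
    and between: "\<And>x. a * (norm x)\<^sup>2 \<le> Re (cinner (A x) x)" "\<And>x. Re (cinner (A x) x) \<le> b * (norm x)\<^sup>2"
    and le: "\<And>t. a \<le> t \<Longrightarrow> t \<le> b \<Longrightarrow> cmod (poly p (of_real t)) \<le> M * cmod (poly q (of_real t))"
    and "0 \<le> M"
  shows "norm (poly_op p A x) \<le> M * norm (poly_op q A x)"
proof -
  define c where "c = complex_of_real (M\<^sup>2)"
  \<comment> \<open>At real points conjugating the coefficients conjugates the value, so there
    \<open>h\<close> is \<open>M\<^sup>2 |q|\<^sup>2 - |p|\<^sup>2\<close>. At \<open>A\<close> it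
    conjugates to adjoints, so the form of \<open>h(A)\<close> is the difference of the squared
    norms to be compared.\<close>
  define h where "h = smult c (map_poly cnj q * q) - map_poly cnj p * p"
  have h_op: "poly_op h A x = c *\<^sub>C poly_op (map_poly cnj q) A (poly_op q A x) -
      poly_op (map_poly cnj p) A (poly_op p A x)" for x
    by (simp add: h_def poly_op_diff[OF A(1)] poly_op_smult[OF A(1)] poly_op_mult[OF A(1)])
  have cnj_op: "cinner (poly_op (map_poly cnj f) A x) y = cinner x (poly_op f A y)" for f x y
    by (metis cinner_commute cinner_poly_op[OF A])
  have form: "cinner (poly_op h A x) y =
      c * cinner (poly_op q A x) (poly_op q A y) - cinner (poly_op p A x) (poly_op p A y)" for x y
    by (simp add: h_op cinner_simps cnj_op)
  have "symmetric_op (poly_op h A)"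
    unfolding symmetric_op_def
  proof (intro allI)
    fix x y
    have "cinner x (poly_op h A y) = cnj (cinner (poly_op h A y) x)"
      by (rule cinner_commute)
    also have "\<dots> = cinner (poly_op h A x) y"
      by (simp add: form c_def flip: cinner_commute)
    finally show "cinner (poly_op h A x) y = cinner x (poly_op h A y)"
      by simp
  qed
  moreover have "0 \<le> Re (poly h (of_real t))" if "a \<le> t" "t \<le> b" for t
  proof -
    have cnj_poly: "poly (map_poly cnj f) (of_real t) = cnj (poly f (of_real t))" for f
      using poly_cnj[of f "of_real t"] by (simp add: map_poly_def)
    have "(cmod (poly p (of_real t)))\<^sup>2 \<le> (M * cmod (poly q (of_real t)))\<^sup>2"
      using le[OF that] by (intro power_mono) auto
    moreover have "poly h (of_real t) =
        of_real ((M * cmod (poly q (of_real t)))\<^sup>2 - (cmod (poly p (of_real t)))\<^sup>2)"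
      by (simp only: h_def poly_diff poly_smult poly_mult cnj_poly c_def of_real_diff of_real_mult
          power_mult_distrib complex_norm_square) (simp add: mult_ac)
    ultimately show ?thesis
      by simp
  qed
  ultimately have "0 \<le> Re (cinner (poly_op h A x) x)"
    using symmetric_op_poly_nonneg[OF A between] by blast
  then have "(norm (poly_op p A x))\<^sup>2 \<le> (M * norm (poly_op q A x))\<^sup>2"
    by (simp add: form c_def Re_cinner_self power_mult_distrib)
  then show ?thesis
    by (rule power2_le_imp_le) (use \<open>0 \<le> M\<close> in simp)
qed

section \<open>Annulus contractions\<close>

lemma onorm_le_iff:
  assumes "bounded_linear T" "0 \<le> b"
  shows "onorm T \<le> b \<longleftrightarrow> (\<forall>x. norm (T x) \<le> b * norm x)"
  using assms onorm[OF assms(1)] onorm_bound[of b T]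
  by (metis mult_right_mono norm_ge_zero order_trans)

lemma C_1_iff:
  assumes T: "invertible_op T" and "0 < r"
  shows "T \<in> C_1 r \<longleftrightarrow> (\<forall>x. r * norm x \<le> norm (T x) \<and> norm (T x) \<le> norm x)"
proof -
  have "bounded_linear (\<lambda>x. r *\<^sub>R inv T x)"
    using bounded_clinearD(1)[OF bounded_clinear_scaleR[OF invertible_opD(2)[OF T]]] .
  then have "onorm (\<lambda>x. r *\<^sub>R inv T x) \<le> 1 \<longleftrightarrow> (\<forall>x. r * norm (inv T x) \<le> norm x)"
    using \<open>0 < r\<close> by (simp add: onorm_le_iff)
  also have "\<dots> \<longleftrightarrow> (\<forall>x. r * norm x \<le> norm (T x))"
    using invertible_opD(3,4)[OF T] by metis
  finally show ?thesis
    using T by (auto simp: C_1_def onorm_le_iff bounded_clinearD invertible_opD)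
qed

text \<open>For \<open>cmod z > 1\<close> write \<open>z - T = z (1 - T / z)\<close>, and for
  \<open>cmod z < r\<close> write \<open>z - T = - (1 - z T\<^sup>-\<^sup>1) T\<close>; in both
  cases the bracket is a strict perturbation of the identity.\<close>

lemma spectrum_subset_closed_annulus:
  assumes T: "invertible_op T" and "0 < r"
    and bounds: "\<And>x. r * norm x \<le> norm (T x)" "\<And>x. norm (T x) \<le> norm x"
  shows "spectrum T \<subseteq> closed_annulus r"
proof
  fix z
  assume z: "z \<in> spectrum T"
  note bT = invertible_opD(1)[OF T]
  have id: "invertible_op (\<lambda>x::'a. x)"
    by (rule invertible_opI[OF bounded_clinear_ident bounded_clinear_ident]) auto
  have "cmod z \<le> 1"
  proof (rule ccontr)
    assume large: "\<not> cmod z \<le> 1"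
    have "invertible_op (\<lambda>x. x - inverse z *\<^sub>C T x)"
    proof (rule invertible_op_ident_minus)
      show "bounded_clinear (\<lambda>x. inverse z *\<^sub>C T x)"
        by (intro bounded_clinear_intros bT)
      show "cmod (inverse z) < 1"
        using large by (simp add: norm_inverse inverse_less_1_iff)
      show "norm (inverse z *\<^sub>C T x) \<le> cmod (inverse z) * norm x" for x
        using bounds(2) by (simp add: norm_scaleC mult_left_mono)
    qed
    then have "invertible_op (\<lambda>x. z *\<^sub>C (x - inverse z *\<^sub>C T x))"
      using large by (intro invertible_op_scaleC) auto
    moreover have "z *\<^sub>C (x - inverse z *\<^sub>C T x) = z *\<^sub>C x - T x" for x
      using large by (cases "z = 0") (auto simp: scaleC_diff_right scaleC_scaleC)
    ultimately show False
      using z by (simp add: spectrum_def)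
  qed
  moreover have "r \<le> cmod z"
  proof (rule ccontr)
    assume small: "\<not> r \<le> cmod z"
    have "invertible_op (\<lambda>x. x - z *\<^sub>C inv T x)"
    proof (rule invertible_op_ident_minus)
      show "bounded_clinear (\<lambda>x. z *\<^sub>C inv T x)"
        by (intro bounded_clinear_intros invertible_opD(2)[OF T])
      show "cmod z / r < 1"
        using small \<open>0 < r\<close> by simp
      have "norm (inv T x) \<le> norm x / r" for x
        using bounds(1)[of "inv T x"] \<open>0 < r\<close> by (simp add: invertible_opD[OF T] field_simps)
      then show "norm (z *\<^sub>C inv T x) \<le> cmod z / r * norm x" for x
        using mult_left_mono[of "norm (inv T x)" "norm x / r" "cmod z"] by (simp add: norm_scaleC)
    qed
    then have "invertible_op (\<lambda>x. - ((\<lambda>x. x - z *\<^sub>C inv T x) (T x)))"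
      by (intro invertible_op_uminus) (rule invertible_op_comp[OF _ T])
    then show False
      using z by (simp add: spectrum_def invertible_opD[OF T])
  qed
  ultimately show "z \<in> closed_annulus r"
    by (simp add: closed_annulus_def)
qed

lemma compact_closed_annulus: "compact (closed_annulus r)"
proof -
  have "closed_annulus r = cball 0 1 \<inter> {z. r \<le> cmod z}"
    by (auto simp: closed_annulus_def)
  then show ?thesis
    by (auto intro!: compact_Int_closed closed_Collect_le continuous_intros)
qed

lemma annulus_contractionD:
  assumes P: "annulus_contraction r P" and r: "0 < r" "r < 1"
  shows "invertible_op P" "r * norm x \<le> norm (P x)" "norm (P x) \<le> norm x"
proof -
  have bP: "bounded_clinear P" and spec: "spectrum P \<subseteq> closed_annulus r"
    and le: "\<And>p q. (\<forall>z\<in>closed_annulus r. poly q z \<noteq> 0) \<Longrightarrow>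
        onorm (poly_op p P \<circ> inv (poly_op q P))
          \<le> (SUP z\<in>closed_annulus r. cmod (poly p z / poly q z))"
    using P by (auto simp: annulus_contraction_def)
  have ne: "closed_annulus r \<noteq> {}"
    using r by (auto simp: closed_annulus_def intro!: exI[of _ 1])
  have X: "poly_op [:0, 1:] P = P" and one: "poly_op 1 P = id"
    using poly_op_X[OF bP] poly_op_const[OF bP, of 1] by (auto simp: one_pCons)
  \<comment> \<open>Since \<open>0 < r\<close>, the origin lies in the hole of the annulus; this is
    what makes \<open>P\<close> invertible.\<close>
  have "0 \<notin> spectrum P"
    using spec r by (auto simp: closed_annulus_def)
  then have "invertible_op (\<lambda>x. - (0 *\<^sub>C x - P x))"
    by (intro invertible_op_uminus) (simp add: spectrum_def)
  then show inv: "invertible_op P"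
    by simp
  have "onorm P \<le> (SUP z\<in>closed_annulus r. cmod (poly [:0, 1:] z / poly 1 z))"
    using le[of 1 "[:0, 1:]"] by (simp add: X one)
  also have "\<dots> \<le> 1"
    using ne by (intro cSUP_least) (auto simp: closed_annulus_def)
  finally have "\<forall>x. norm (P x) \<le> 1 * norm x"
    using bounded_clinearD(1)[OF bP] by (subst (asm) onorm_le_iff) auto
  then show "norm (P x) \<le> norm x"
    by simp
  have "onorm (inv P) \<le> (SUP z\<in>closed_annulus r. cmod (poly 1 z / poly [:0, 1:] z))"
  proof -
    have "\<forall>z\<in>closed_annulus r. poly [:0, 1:] z \<noteq> 0"
      using r by (auto simp: closed_annulus_def)
    from le[OF this, of 1] show ?thesis
      by (simp add: X one)
  qed
  also have "\<dots> \<le> 1 / r"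
    using ne r by (intro cSUP_least) (auto simp: closed_annulus_def norm_divide intro!: frac_le)
  finally have "\<forall>x. norm (inv P x) \<le> 1 / r * norm x"
    using bounded_clinearD(1)[OF invertible_opD(2)[OF inv]] r
    by (subst (asm) onorm_le_iff) auto
  then have "norm (inv P (P x)) \<le> 1 / r * norm (P x)"
    by blast
  then show "r * norm x \<le> norm (P x)"
    using r by (simp add: invertible_opD[OF inv] field_simps)
qed

lemma annulus_contractionI:
  assumes P: "invertible_op P" "symmetric_op P" "\<And>x. 0 \<le> Re (cinner (P x) x)" and r: "0 < r" "r < 1"
    and bounds: "\<And>x. r * norm x \<le> norm (P x)" "\<And>x. norm (P x) \<le> norm x"
  shows "annulus_contraction r P"
proof -
  note bP = invertible_opD(1)[OF P(1)] and bR = invertible_opD(2)[OF P(1)]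
  note inv = invertible_opD(3,4)[OF P(1)]
  have upper: "Re (cinner (P x) x) \<le> 1 * (norm x)\<^sup>2" for x
  proof -
    have "Re (cinner (P x) x) \<le> norm (P x) * norm x"
      by (rule Re_cinner_le)
    also have "\<dots> \<le> norm x * norm x"
      using bounds(2) by (intro mult_right_mono) auto
    finally show ?thesis
      by (simp add: power2_eq_square)
  qed
  \<comment> \<open>A lower norm bound becomes a form bound only through positivity: the square
    inequality is applied to the positive operator \<open>inv P\<close>, whose form is at most
    \<open>1 / r\<close> on unit vectors, at the vector \<open>P x\<close>.\<close>
  have lower: "r * (norm x)\<^sup>2 \<le> Re (cinner (P x) x)" for x
  proof -
    have form: "cinner (inv P y) y = cinner (P (inv P y)) (inv P y)" for y
      by (metis inv(1) P(2) symmetric_opD)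
    have "(norm (inv P (P x)))\<^sup>2 \<le> (1 / r) * Re (cinner (inv P (P x)) (P x))"
    proof (rule symmetric_op_square_le[OF bR])
      show "symmetric_op (inv P)"
        unfolding symmetric_op_def by (metis inv(1) P(2) symmetric_opD)
      show "0 \<le> Re (cinner (inv P y) y)" for y
        unfolding form by (rule P(3))
      show "Re (cinner (inv P y) y) \<le> 1 / r * (norm y)\<^sup>2" for y
      proof -
        have "Re (cinner (inv P y) y) \<le> norm (inv P y) * norm y"
          by (rule Re_cinner_le)
        also have "\<dots> \<le> (norm y / r) * norm y"
          using bounds(1)[of "inv P y"] r by (intro mult_right_mono) (auto simp: inv field_simps)
        finally show ?thesis
          by (simp add: power2_eq_square)
      qed
    qed
    then show ?thesis
      using r by (simp add: inv field_simps symmetric_opD[OF P(2), of x x])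
  qed
  have spec: "spectrum P \<subseteq> closed_annulus r"
    by (rule spectrum_subset_closed_annulus) fact+
  have "onorm (poly_op p P \<circ> inv (poly_op q P))
      \<le> (SUP z\<in>closed_annulus r. cmod (poly p z / poly q z))" (is "_ \<le> ?M")
    if q: "\<forall>z\<in>closed_annulus r. poly q z \<noteq> 0" for p q
  proof -
    \<comment> \<open>A real supremum bounds its members only if they are bounded; here compactness
      and the absence of zeros of \<open>q\<close> ensure this.\<close>
    have "continuous_on (closed_annulus r) (\<lambda>z. cmod (poly p z / poly q z))"
      using q by (intro continuous_intros) auto
    then have bdd: "bdd_above ((\<lambda>z. cmod (poly p z / poly q z)) ` closed_annulus r)"
      by (intro bounded_imp_bdd_above compact_imp_bounded compact_continuous_image
          compact_closed_annulus)
    have le_M: "cmod (poly p z / poly q z) \<le> ?M" if "z \<in> closed_annulus r" for z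
      by (rule cSUP_upper[OF that bdd])
    have one: "1 \<in> closed_annulus r"
      using r by (simp add: closed_annulus_def)
    have "0 \<le> ?M"
      using order_trans[OF norm_ge_zero le_M[OF one]] .
    have "q \<noteq> 0"
      using q one by auto
    then have inv_q: "invertible_op (poly_op q P)"
      using q spec by (intro invertible_poly_op[OF bP]) auto
    show ?thesis
    proof (rule onorm_bound[OF \<open>0 \<le> ?M\<close>])
      fix x
      have "norm (poly_op p P (inv (poly_op q P) x))
          \<le> ?M * norm (poly_op q P (inv (poly_op q P) x))"
      proof (rule symmetric_op_poly_norm_le[OF bP P(2) lower upper _ \<open>0 \<le> ?M\<close>])
        fix t
        assume t: "r \<le> t" "t \<le> 1"
        then have "complex_of_real t \<in> closed_annulus r"
          using r by (simp add: closed_annulus_def)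
        then show "cmod (poly p (of_real t)) \<le> ?M * cmod (poly q (of_real t))"
          using le_M[of "of_real t"] q by (simp add: norm_divide divide_le_eq)
      qed
      then show "norm ((poly_op p P \<circ> inv (poly_op q P)) x) \<le> ?M * norm x"
        by (simp add: invertible_opD[OF inv_q])
    qed
  qed
  then show ?thesis
    using bP spec by (simp add: annulus_contraction_def)
qed

section \<open>The equivalences\<close>

lemma norm_unitary_op:
  assumes "unitary_op U"
  shows "norm (U x) = norm x"
proof -
  have U: "bounded_clinear U" "adj U (U x) = x"
    using assms by (auto simp: unitary_op_def fun_eq_iff)
  have "(norm (U x))\<^sup>2 = (norm x)\<^sup>2"
    using cinner_adj[OF U(1), of x "U x"] by (simp add: U(2) flip: Re_cinner_self)
  then show ?thesis
    by simp
qed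

text \<open>The strict lower bound is \<open>(1 / k)\<^sup>2\<close> for a norm bound
  \<open>k\<close> of \<open>inv T\<close>. The last item identifies the operator in condition (2)
  as a right inverse of \<open>A\<close>.\<close>

lemma adj_comp_self:
  assumes T: "invertible_op T"
  defines "A \<equiv> adj T \<circ> T"
  shows "bounded_clinear A" "symmetric_op A" "Re (cinner (A x) x) = (norm (T x))\<^sup>2"
    "\<exists>c>0. \<forall>x. c * (norm x)\<^sup>2 \<le> Re (cinner (A x) x)"
    "A (inv T (adj (inv T) x)) = x"
proof -
  note bT = invertible_opD(1)[OF T] and bR = invertible_opD(2)[OF T]
  show "bounded_clinear A"
    unfolding A_def o_def by (rule bounded_clinear_comp[OF bounded_clinear_adj[OF bT] bT])
  show "symmetric_op A"
    by (simp add: symmetric_op_def A_def cinner_adj_left[OF bT] flip: cinner_adj[OF bT])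
  show form: "Re (cinner (A x) x) = (norm (T x))\<^sup>2" for x
    by (simp add: A_def cinner_adj_left[OF bT] cinner_self)
  obtain k where k: "0 < k" "\<And>x. norm (inv T x) \<le> k * norm x"
    using bounded_clinear_bound[OF bR] by metis
  have "(1 / k)\<^sup>2 * (norm x)\<^sup>2 \<le> Re (cinner (A x) x)" for x
  proof -
    have "norm x / k \<le> norm (T x)"
      using k(2)[of "T x"] k(1) by (simp add: invertible_opD[OF T] field_simps)
    then have "(norm x / k)\<^sup>2 \<le> (norm (T x))\<^sup>2"
      using k(1) by (intro power_mono) auto
    then show ?thesis
      by (simp add: form power_divide)
  qed
  then show "\<exists>c>0. \<forall>x. c * (norm x)\<^sup>2 \<le> Re (cinner (A x) x)"
    using k(1) by (intro exI[of _ "(1 / k)\<^sup>2"]) simp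
  have "adj T (adj (inv T) x) = x"
    by (rule cinner_ext)
      (simp add: invertible_opD[OF T] flip: cinner_adj[OF bT] cinner_adj[OF bR])
  then show "A (inv T (adj (inv T) x)) = x"
    by (simp add: A_def invertible_opD[OF T])
qed

theorem theorem1p4:
  fixes r :: real and T :: "'h::complex_hilbert \<Rightarrow> 'h"
  assumes "0 < r" and "r < 1" and "invertible_op T"
  shows "(T \<in> C_1 r \<longleftrightarrow>
            positive_op (\<lambda>x. (1 + r\<^sup>2) *\<^sub>R x - adj T (T x) - r\<^sup>2 *\<^sub>R inv T (adj (inv T) x)))
       \<and> (T \<in> C_1 r \<longleftrightarrow> sqrt_op (adj T \<circ> T) \<in> C_alpha r)
       \<and> (T \<in> C_1 r \<longleftrightarrow> annulus_contraction r (sqrt_op (adj T \<circ> T)))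
       \<and> (T \<in> C_1 r \<longleftrightarrow> (\<exists>U P. unitary_op U \<and> annulus_contraction r P \<and> T = U \<circ> P))"
proof -
  note r = assms(1,2) and T = assms(3)
  note bT = invertible_opD(1)[OF T] and bR = invertible_opD(2)[OF T] and invT = invertible_opD(3,4)[OF T]
  define A where "A = adj T \<circ> T"
  define P where "P = sqrt_op A"
  note A = adj_comp_self[OF T, folded A_def]
  obtain c where c: "0 < c" "\<And>x. c * (norm x)\<^sup>2 \<le> Re (cinner (A x) x)"
    using A(4) by blast
  note P = sqrt_op_properties[OF A(1,2) c, folded P_def]
  have norm_P: "norm (P x) = norm (T x)" for x
  proof -
    have "(norm (P x))\<^sup>2 = (norm (T x))\<^sup>2"
      using symmetric_opD[OF P(2), of "P x" x] A(3)[of x] by (simp add: P(3) cinner_self)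
    then show ?thesis
      by simp
  qed
  \<comment> \<open>This is \<open>P A\<^sup>-\<^sup>1\<close>, the inverse of
    \<open>P\<close>.\<close>
  define R where "R x = P (inv T (adj (inv T) x))" for x
  have R: "P (R x) = x" "R (P x) = x" for x
  proof -
    show PR: "P (R x) = x" for x
      by (simp add: R_def P(3) A(5))
    have "inj P"
      by (rule injI) (metis norm_P P(1) bounded_clinearD(4) invT(2) eq_iff_diff_eq_0 norm_eq_zero
          bounded_clinearD(6) bT)
    then show "R (P x) = x"
      using PR by (metis injD)
  qed
  have bRR: "bounded_clinear (\<lambda>x. inv T (adj (inv T) x))"
    by (rule bounded_clinear_comp[OF bR bounded_clinear_adj[OF bR]])
  have bcR: "bounded_clinear R"
    unfolding R_def by (rule bounded_clinear_comp[OF P(1) bRR])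
  have invP: "invertible_op P"
    by (rule invertible_opI[OF P(1) bcR R(2,1)])
  define E where "E \<longleftrightarrow> (\<forall>x. r * norm x \<le> norm (T x) \<and> norm (T x) \<le> norm x)"
  have C1: "T \<in> C_1 r \<longleftrightarrow> E"
    unfolding E_def by (rule C_1_iff[OF T r(1)])
  \<comment> \<open>The form of \<open>(1 - A) (A - r\<^sup>2)\<close>, kept in the shape that
    \<open>symmetric_op_between_iff\<close> has for \<open>a = r\<^sup>2\<close> and
    \<open>b = 1\<close>.\<close>
  define \<psi> where "\<psi> x = (r\<^sup>2 + 1) * Re (cinner (A x) x) - (norm (A x))\<^sup>2 - r\<^sup>2 * 1 * (norm x)\<^sup>2" for x
  have E_iff: "E \<longleftrightarrow> (\<forall>x. 0 \<le> \<psi> x)"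
  proof -
    have "(\<forall>x. 0 \<le> \<psi> x) \<longleftrightarrow>
        (\<forall>x. r\<^sup>2 * (norm x)\<^sup>2 \<le> Re (cinner (A x) x) \<and> Re (cinner (A x) x) \<le> 1 * (norm x)\<^sup>2)"
      unfolding \<psi>_def using r by (intro symmetric_op_between_iff A) (simp add: power_le_one)
    also have "\<dots> \<longleftrightarrow> E"
      using r by (simp add: E_def A(3) abs_le_square_iff[symmetric] flip: power_mult_distrib)
    finally show ?thesis
      by simp
  qed

  have two: "positive_op (\<lambda>x. (1 + r\<^sup>2) *\<^sub>R x - adj T (T x) - r\<^sup>2 *\<^sub>R inv T (adj (inv T) x)) \<longleftrightarrow> E"
  proof -
    define G where "G x = (1 + r\<^sup>2) *\<^sub>R x - A x - r\<^sup>2 *\<^sub>R inv T (adj (inv T) x)" for x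
    have bG: "bounded_clinear G"
      unfolding G_def by (intro bounded_clinear_intros A(1) bRR)
    have "symmetric_op G"
      using A(2) by (simp add: symmetric_op_def G_def cinner_simps cinner_adj[OF bR]
          cinner_adj_left[OF bR])
    \<comment> \<open>Since \<open>P A\<^sup>-\<^sup>1 P = 1\<close>, the form of
      \<open>P G P\<close> is \<open>\<psi>\<close>; \<open>P\<close> is onto, so vectors
      \<open>P y\<close> suffice as test vectors.\<close>
    moreover have "Re (cinner (G (P y)) (P y)) = \<psi> y" for y
    proof -
      have "P (inv T (adj (inv T) (P y))) = y"
        using R(2) by (simp add: R_def)
      then have "cinner (inv T (adj (inv T) (P y))) (P y) = cinner y y"
        by (metis P(2) symmetric_opD)
      moreover have "Re (cinner (P y) (P y)) = Re (cinner (A y) y)"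
        by (metis P(2) P(3) symmetric_opD)
      moreover have "cinner (A (P y)) (P y) = cinner (A y) (A y)"
        by (metis P(2) P(3) symmetric_opD)
      ultimately show ?thesis
        by (simp add: G_def \<psi>_def cinner_simps Re_cinner_self)
    qed
    ultimately have "positive_op G \<longleftrightarrow> (\<forall>y. 0 \<le> \<psi> y)"
      using positive_op_iff[OF bG] R by metis
    then show ?thesis
      using E_iff by (simp add: G_def[abs_def] A_def)
  qed

  have three: "P \<in> C_alpha r \<longleftrightarrow> E"
  proof -
    define G where "G x = - (adj P ^^ 2) ((P ^^ 2) x) + (1 + r\<^sup>2) *\<^sub>R adj P (P x) - r\<^sup>2 *\<^sub>R x" for x
    have G_eq: "G x = - A (A x) + (1 + r\<^sup>2) *\<^sub>R A x - r\<^sup>2 *\<^sub>R x" for x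
      by (simp add: G_def adj_symmetric[OF P(2)] P(3) numeral_2_eq_2)
    have "bounded_clinear G"
      unfolding G_eq[abs_def] by (intro bounded_clinear_intros A(1) bounded_clinear_comp[OF A(1) A(1)])
    moreover have "symmetric_op G"
      using A(2) by (simp add: symmetric_op_def G_eq cinner_simps)
    moreover have "Re (cinner (G x) x) = \<psi> x" for x
      using symmetric_opD[OF A(2), of "A x" x]
      by (simp add: G_eq \<psi>_def cinner_simps Re_cinner_self)
    ultimately have "positive_op G \<longleftrightarrow> E"
      by (simp add: positive_op_iff E_iff)
    then show ?thesis
      using invP by (simp add: C_alpha_def G_def[abs_def])
  qed

  have four: "annulus_contraction r P \<longleftrightarrow> E"
  proof
    assume "annulus_contraction r P"
    from annulus_contractionD[OF this r] show E
      by (simp add: E_def norm_P)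
  next
    assume E
    then show "annulus_contraction r P"
      by (intro annulus_contractionI[OF invP P(2,4) r]) (auto simp: E_def norm_P)
  qed

  have five: "(\<exists>U Q. unitary_op U \<and> annulus_contraction r Q \<and> T = U \<circ> Q) \<longleftrightarrow> E"
  proof
    assume "\<exists>U Q. unitary_op U \<and> annulus_contraction r Q \<and> T = U \<circ> Q"
    then obtain U Q where "unitary_op U" "annulus_contraction r Q" "T = U \<circ> Q"
      by blast
    \<comment> \<open>\<open>Q\<close> need not be positive: \<open>U\<close> is isometric, so
      \<open>T\<close> inherits the two norm bounds of \<open>Q\<close>.\<close>
    then show E
      using annulus_contractionD[of r Q] r by (simp add: E_def norm_unitary_op)
  next
    assume E
    \<comment> \<open>The polar factor \<open>T P\<^sup>-\<^sup>1\<close>. Unitarity follows from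
      \<open>adj U = P\<^sup>-\<^sup>1 (adj T)\<close> and
      \<open>adj T = P\<^sup>2 T\<^sup>-\<^sup>1\<close>.\<close>
    define U where "U x = T (R x)" for x
    have bU: "bounded_clinear U"
      unfolding U_def by (rule bounded_clinear_comp[OF bT bcR])
    have adj_U: "adj U = (\<lambda>x. R (adj T x))"
    proof (rule adj_eqI)
      have "cinner (R x) y = cinner x (R y)" for x y
        by (metis R(1) P(2) symmetric_opD)
      then show "cinner (U x) y = cinner x (R (adj T y))" for x y
        by (simp add: U_def cinner_adj[OF bT])
    qed
    have adj_T: "adj T y = P (P (inv T y))" for y
      by (simp add: P(3) A_def invT)
    have "unitary_op U"
      using bU by (auto simp: unitary_op_def adj_U fun_eq_iff adj_T U_def R invT)
    moreover have "T = U \<circ> P"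
      by (simp add: fun_eq_iff U_def R)
    ultimately show "\<exists>U Q. unitary_op U \<and> annulus_contraction r Q \<and> T = U \<circ> Q"
      using four \<open>E\<close> by blast
  qed

  show ?thesis
    unfolding A_def[symmetric] P_def[symmetric] C1 two three four five by simp
qed

end
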